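(* Let $n \geq 0$ and let $\mathrm{Val}_n$ denote the real vector space of continuous invariant valuations on $\mathcal{C}_n$, the set of compact $\ell_1$-convex subsets of $\mathbb{R}^n$. Then the $\ell_1$-intrinsic volumes $V_0, \ldots, V_n$ form a basis of $\mathrm{Val}_n$. In particular, $\dim(\mathrm{Val}_n) = n+1$.
   Context: $\ell_1^n$ denotes $\mathbb{R}^n$ with the metric $d(x,y)=\sum_i |x_i-y_i|$. A subset $X\subseteq\mathbb{R}^n$ is $\ell_1$-convex if for all $x,x'\in X$, with $D=d(x,x')$, there is a map $\gamma\colon[0,D]\to X$ with $\gamma(0)=x$, $\gamma(D)=x'$ and $d(\gamma(t),\gamma(t'))=|t-t'|$ for all $t,t'$. $\mathcal{C}_n$ is the set of compact $\ell_1$-convex subsets of $\mathbb{R}^n$ (including $\emptyset$). A valuation on $\mathcal{C}_n$ is a function $\phi\colon\mathcal{C}_n\to\mathbb{R}$ with $\phi(\emptyset)=0$ and $\phi(X\cup Y)=\phi(X)+\phi(Y)-\phi(X\cap Y)$ whenever $X,Y,X\cup Y,X\cap Y\in\mathcal{C}_n$. It is continuous if continuous with respect to the Hausdorff metric (induced by the $\ell_1$ metric), and invariant if $\phi(gX)=\phi(X)$ for every isometry $g$ of $\ell_1^n$ (the isometry group is generated by translations, coordinate permutations and reflections in coordinate hyperplanes). A coordinate subspace is a linear subspace spanned by a subset of the standard basis; $G_{n,i}$ is the set of $i$-dimensional coordinate subspaces and $\pi_P$ is orthogonal projection onto $P$. The $i$th $\ell_1$-intrinsic volume is $V_i(X)=\sum_{P\in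 G_{n,i}}\mathrm{Vol}_i(\pi_P X)$, where $\mathrm{Vol}_i$ is Lebesgue measure on $P\cong\mathbb{R}^i$. *)

theory Defs
  imports "HOL-Analysis.Analysis" "HOL-Probability.Probability"
begin

text \<open>R^n is modelled as the functions nat => real vanishing outside {..<n}
(this allows n = 0, where R^0 is a single point).\<close>

definition Rn :: "nat \<Rightarrow> (nat \<Rightarrow> real) set" where
  "Rn n = {x. \<forall>i. n \<le> i \<longrightarrow> x i = 0}"

definition l1dist :: "nat \<Rightarrow> (nat \<Rightarrow> real) \<Rightarrow> (nat \<Rightarrow> real) \<Rightarrow> real" where
  "l1dist n x y = (\<Sum>i<n. \<bar>x i - y i\<bar>)"

definition l1convex :: "nat \<Rightarrow> (nat \<Rightarrow> real) set \<Rightarrow> bool" where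
  "l1convex n X \<longleftrightarrow> (\<forall>x\<in>X. \<forall>x'\<in>X. \<exists>\<gamma> :: real \<Rightarrow> (nat \<Rightarrow> real).
      \<gamma> 0 = x \<and> \<gamma> (l1dist n x x') = x' \<and>
      (\<forall>t\<in>{0..l1dist n x x'}. \<gamma> t \<in> X) \<and>
      (\<forall>t\<in>{0..l1dist n x x'}. \<forall>t'\<in>{0..l1dist n x x'}.
          l1dist n (\<gamma> t) (\<gamma> t') = \<bar>t - t'\<bar>))"

definition Cn :: "nat \<Rightarrow> (nat \<Rightarrow> real) set set" where
  "Cn n = {X. X \<subseteq> Rn n \<and> compactin (Metric_space.mtopology (Rn n) (l1dist n)) X
              \<and> l1convex n X}"

definition hdist :: "nat \<Rightarrow> (nat \<Rightarrow> real) set \<Rightarrow> (nat \<Rightarrow> real) set \<Rightarrow> real" where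
  "hdist n X Y = max (SUP x\<in>X. INF y\<in>Y. l1dist n x y) (SUP y\<in>Y. INF x\<in>X. l1dist n x y)"

definition valuation :: "nat \<Rightarrow> ((nat \<Rightarrow> real) set \<Rightarrow> real) \<Rightarrow> bool" where
  "valuation n \<phi> \<longleftrightarrow> \<phi> {} = 0 \<and>
     (\<forall>X Y. X \<in> Cn n \<longrightarrow> Y \<in> Cn n \<longrightarrow> X \<union> Y \<in> Cn n \<longrightarrow> X \<inter> Y \<in> Cn n \<longrightarrow>
        \<phi> (X \<union> Y) = \<phi> X + \<phi> Y - \<phi> (X \<inter> Y))"

text \<open>Continuity w.r.t. the Hausdorff metric; the empty set is an isolated point
  of the Hausdorff metric space, so only nonempty sets need to be considered.\<close>
definition hcontinuous :: "nat \<Rightarrow> ((nat \<Rightarrow> real) set \<Rightarrow> real) \<Rightarrow> bool" where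
  "hcontinuous n \<phi> \<longleftrightarrow> (\<forall>X\<in>Cn n - {{}}. \<forall>\<epsilon>>0. \<exists>\<delta>>0. \<forall>Y\<in>Cn n - {{}}.
      hdist n X Y < \<delta> \<longrightarrow> \<bar>\<phi> Y - \<phi> X\<bar> < \<epsilon>)"

definition l1isometry :: "nat \<Rightarrow> ((nat \<Rightarrow> real) \<Rightarrow> (nat \<Rightarrow> real)) \<Rightarrow> bool" where
  "l1isometry n g \<longleftrightarrow> g ` Rn n = Rn n \<and>
      (\<forall>x\<in>Rn n. \<forall>y\<in>Rn n. l1dist n (g x) (g y) = l1dist n x y)"

definition invariant :: "nat \<Rightarrow> ((nat \<Rightarrow> real) set \<Rightarrow> real) \<Rightarrow> bool" where
  "invariant n \<phi> \<longleftrightarrow> (\<forall>g. l1isometry n g \<longrightarrow> (\<forall>X\<in>Cn n. \<phi> (g ` X) = \<phi> X))"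

definition Val :: "nat \<Rightarrow> ((nat \<Rightarrow> real) set \<Rightarrow> real) set" where
  "Val n = {\<phi>. valuation n \<phi> \<and> hcontinuous n \<phi> \<and> invariant n \<phi>}"

text \<open>i-th l1-intrinsic volume: sum over i-dimensional coordinate subspaces
  (index sets S of size i) of the i-dimensional Lebesgue measure of the
  orthogonal projection, identified with a subset of R^S.\<close>
definition intrinsic_volume :: "nat \<Rightarrow> nat \<Rightarrow> (nat \<Rightarrow> real) set \<Rightarrow> real" where
  "intrinsic_volume n i X =
     (\<Sum>S\<in>{S. S \<subseteq> {..<n} \<and> card S = i}.
        measure (PiM S (\<lambda>_. lborel)) ((\<lambda>x. restrict x S) ` X))"

end

theory Submission
  imports Defs
begin

text \<open>The heart of the matter is that a continuous valuation vanishing on all axis-parallel boxes (possibly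
  degenerate) vanishes identically. By induction on the set of active coordinates it vanishes on
  cylinders. Pulling a set \<open>X\<close> along a coordinate to the two opposite walls of a bounding box gives two
  l1-convex sets with intersection \<open>X\<close> and union a cylinder, so it suffices to treat sets pulled
  along every coordinate, that is, sets which contain with each point the box it spans with a fixed
  corner. Such a set is a limit of finite unions of boxes sharing that corner, and these boxes are closed
  under intersection.

  A continuous invariant valuation is affine in each side length of a box (Cauchy's equation), so it is
  determined on boxes by its values on the unit cubes of dimensions \<open>k = 0, \<dots>, n\<close>. On these
  \<open>V\<^sub>i\<close> takes the value \<open>k choose i\<close>, a unitriangular system, which yields both
  spanning and independence.\<close>

section \<open>Geodesics\<close>

text \<open>That the intrinsic volumes lie in \<open>Val n\<close> has obstacles of its own. Volumes
  of projections of compact sets are in general only upper semicontinuous for the Hausdorff metric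
  (finite nets of a cube have volume 0), and projections do not commute with intersections.
  Convexity repairs both: fibres in a coordinate direction are intervals, also after a coordinate
  projection, and a geodesic between two points of one fibre stays in it. Isometries are given by
  distances alone, so invariance rests on first finding their explicit form.

  In the vanishing argument the difficulty is that \<open>Cn n\<close> is closed neither under
  unions nor under intersections, so inclusion-exclusion over an arbitrary approximation by boxes
  would leave it. A common corner keeps every partial union and intersection inside.

  Geodesics are used as continuous paths that are monotone in each coordinate. Reparametrisation by
  arc length passes between the two forms, and coordinatewise monotone maps visibly preserve the
  second.\<close>

lemma l1dist_nonneg [simp]: "0 \<le> l1dist n x y"
  by (simp add: l1dist_def sum_nonneg)

lemma l1dist_commute: "l1dist n x y = l1dist n y x"
  by (simp add: l1dist_def abs_minus_commute)

lemma l1dist_self [simp]: "l1dist n x x = 0"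
  by (simp add: l1dist_def)

lemma l1dist_triangle: "l1dist n x z \<le> l1dist n x y + l1dist n y z"
  unfolding l1dist_def sum.distrib[symmetric] by (rule sum_mono) linarith

lemma coord_le_l1dist: "j < n \<Longrightarrow> \<bar>x j - y j\<bar> \<le> l1dist n x y"
  unfolding l1dist_def by (rule member_le_sum) auto

lemma Rn_coord: "x \<in> Rn n \<Longrightarrow> n \<le> j \<Longrightarrow> x j = 0"
  by (simp add: Rn_def)

lemma Rn_eqI: "x \<in> Rn n \<Longrightarrow> y \<in> Rn n \<Longrightarrow> (\<And>j. j < n \<Longrightarrow> x j = y j) \<Longrightarrow> x = y"
  by (metis Rn_coord ext not_less)

lemma l1dist_eq_0: "x \<in> Rn n \<Longrightarrow> y \<in> Rn n \<Longrightarrow> l1dist n x y = 0 \<longleftrightarrow> x = y"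
  using coord_le_l1dist[of _ n x y] by (auto intro!: Rn_eqI)

lemma continuous_on_l1dist [continuous_intros]:
  assumes "continuous_on A f" "continuous_on A g"
  shows "continuous_on A (\<lambda>t. l1dist n (f t) (g t))"
  unfolding l1dist_def
  by (intro continuous_intros continuous_on_product_then_coordinatewise[OF assms(1)]
        continuous_on_product_then_coordinatewise[OF assms(2)])

text \<open>Each coordinate has a nonnegative defect in the triangle inequality of the reals; if the
  defects add up to 0, all of them are 0.\<close>

lemma l1dist_additive_coord:
  assumes "l1dist n x y + l1dist n y z = l1dist n x z" "j < n"
  shows "\<bar>x j - y j\<bar> + \<bar>y j - z j\<bar> = \<bar>x j - z j\<bar>"
proof -
  have "(\<Sum>j<n. \<bar>x j - y j\<bar> + \<bar>y j - z j\<bar> - \<bar>x j - z j\<bar>) = 0"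
    using assms(1) by (simp add: l1dist_def sum.distrib sum_subtractf)
  then have "\<forall>j\<in>{..<n}. \<bar>x j - y j\<bar> + \<bar>y j - z j\<bar> - \<bar>x j - z j\<bar> = 0"
    by (subst (asm) sum_nonneg_eq_0_iff) auto
  then show ?thesis using assms(2) by auto
qed

section \<open>The l1 metric and the product topology\<close>

lemma Metric_space_l1: "Metric_space (Rn n) (l1dist n)"
  by unfold_locales (auto simp: l1dist_commute l1dist_eq_0 l1dist_triangle)

lemma dist_fun_small:
  fixes x :: "nat \<Rightarrow> real"
  assumes "0 < e"
  obtains r where "0 < r" "\<And>y. (\<And>j. \<bar>x j - y j\<bar> < r) \<Longrightarrow> dist x y < e"
proof -
  obtain N where N: "(1/2::real)^N < e/2"
    using real_arch_pow_inv[of "e/2" "1/2"] assms by auto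
  \<comment> \<open>The distance on functions is at most twice the maximum over the first
    coordinates plus the tail \<open>(1/2)^N\<close>; the bounds \<open>e/4\<close> and
    \<open>e/2\<close> share out \<open>e\<close> accordingly.\<close>
  have "dist x y < e" if y: "\<And>j. \<bar>x j - y j\<bar> < e/4" for y
  proof -
    let ?M = "{dist (x (from_nat n)) (y (from_nat n)) |n. n \<le> N}"
    have "?M = (\<lambda>n. dist (x (from_nat n)) (y (from_nat n))) ` {..N}" by auto
    moreover have "Max ((\<lambda>n. dist (x (from_nat n)) (y (from_nat n))) ` {..N}) < e/4"
      by (subst Max_less_iff) (use y in \<open>auto simp: dist_real_def\<close>)
    ultimately have "Max ?M < e/4" by simp
    then show ?thesis
      using dist_fun_le_dist_first_terms[of x y N] N by linarith
  qed
  then show ?thesis using that[of "e/4"] assms by auto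
qed

text \<open>On \<open>Rn n\<close> only finitely many coordinates vary, so an l1 ball and a product
  neighbourhood each contain one of the other kind. From here on compactness and continuity are
  those of the function space.\<close>

lemma mtopology_l1: "Metric_space.mtopology (Rn n) (l1dist n) = top_of_set (Rn n)"
proof -
  interpret M: Metric_space "Rn n" "l1dist n" by (rule Metric_space_l1)
  have cont: "continuous_on UNIV (\<lambda>y. l1dist n x y)" for x
    by (intro continuous_intros)
  show ?thesis
  proof (rule topology_eq[THEN iffD2], intro allI iffI)
    fix U assume U: "openin M.mtopology U"
    then have "U \<subseteq> Rn n" using M.openin_mtopology by auto
    moreover have "\<exists>e>0. \<forall>y\<in>Rn n. dist y x < e \<longrightarrow> y \<in> U" if x: "x \<in> U" for x
    proof -
      obtain r where r: "r > 0" "M.mball x r \<subseteq> U" using U x M.openin_mtopology by blast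
      have "open {y. l1dist n x y < r}"
        by (rule open_Collect_less) (intro continuous_intros)+
      moreover have "x \<in> {y. l1dist n x y < r}" using r by simp
      ultimately obtain e where e: "e > 0" "\<And>y. dist y x < e \<Longrightarrow> y \<in> {y. l1dist n x y < r}"
        unfolding open_dist by blast
      then show ?thesis using r x \<open>U \<subseteq> Rn n\<close> by (intro exI[of _ e]) (auto simp: subset_iff)
    qed
    ultimately show "openin (top_of_set (Rn n)) U"
      unfolding openin_euclidean_subtopology_iff by blast
  next
    fix U assume U: "openin (top_of_set (Rn n)) U"
    then have UR: "U \<subseteq> Rn n" by (simp add: openin_euclidean_subtopology_iff)
    have "\<exists>r>0. M.mball x r \<subseteq> U" if x: "x \<in> U" for x
    proof -
      obtain e where e: "e > 0" "\<And>y. y \<in> Rn n \<Longrightarrow> dist y x < e \<Longrightarrow> y \<in> U"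
        using U x unfolding openin_euclidean_subtopology_iff by blast
      obtain r where r: "0 < r" "\<And>y. (\<And>j. \<bar>x j - y j\<bar> < r) \<Longrightarrow> dist x y < e"
        using dist_fun_small[OF e(1)] by blast
      have "y \<in> U" if "y \<in> M.mball x r" for y
      proof (rule e(2))
        show "y \<in> Rn n" using that by auto
        have "\<bar>x j - y j\<bar> < r" for j
        proof (cases "j < n")
          case True then show ?thesis using coord_le_l1dist[OF True, of x y] that by simp
        next
          case False then show ?thesis using that r(1) x UR by (auto simp: subset_iff Rn_coord)
        qed
        then show "dist y x < e" using r(2) by (subst dist_commute) blast
      qed
      then show ?thesis using r(1) by blast
    qed
    then show "openin M.mtopology U" using UR M.openin_mtopology by auto
  qed
qed

lemma Cn_iff: "X \<in> Cn n \<longleftrightarrow> X \<subseteq> Rn n \<and> compact X \<and> l1convex n X"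
  by (auto simp: Cn_def mtopology_l1 compactin_subtopology)

lemma CnD: assumes "X \<in> Cn n" shows "X \<subseteq> Rn n" "compact X" "l1convex n X"
  using assms by (auto simp: Cn_iff)

section \<open>Geodesics and coordinatewise monotone paths\<close>

definition geod :: "nat \<Rightarrow> (nat \<Rightarrow> real) set \<Rightarrow> (nat \<Rightarrow> real) \<Rightarrow> (nat \<Rightarrow> real) \<Rightarrow> bool" where
  "geod n X x y \<longleftrightarrow> (\<exists>\<gamma> :: real \<Rightarrow> (nat \<Rightarrow> real).
      \<gamma> 0 = x \<and> \<gamma> (l1dist n x y) = y \<and>
      (\<forall>t\<in>{0..l1dist n x y}. \<gamma> t \<in> X) \<and>
      (\<forall>t\<in>{0..l1dist n x y}. \<forall>t'\<in>{0..l1dist n x y}. l1dist n (\<gamma> t) (\<gamma> t') = \<bar>t - t'\<bar>))"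

lemma l1convex_geod: "l1convex n X \<longleftrightarrow> (\<forall>x\<in>X. \<forall>y\<in>X. geod n X x y)"
  by (simp add: l1convex_def geod_def)

lemma geod_sym:
  assumes "geod n X x y" shows "geod n X y x"
proof -
  let ?D = "l1dist n x y"
  obtain \<gamma> where g: "\<gamma> 0 = x" "\<gamma> ?D = y" "\<forall>t\<in>{0..?D}. \<gamma> t \<in> X"
    "\<forall>t\<in>{0..?D}. \<forall>t'\<in>{0..?D}. l1dist n (\<gamma> t) (\<gamma> t') = \<bar>t - t'\<bar>"
    using assms unfolding geod_def by blast
  show ?thesis unfolding geod_def
    by (rule exI[of _ "\<lambda>t. \<gamma> (?D - t)"]) (use g in \<open>auto simp: l1dist_commute[of n y x]\<close>)
qed

text \<open>Since \<open>m\<close> lies metrically between the ends, every triangle inequality along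
  the concatenated path is an equality.\<close>

lemma geod_trans:
  assumes xm: "geod n X x m" and my: "geod n X m y"
    and btw: "l1dist n x m + l1dist n m y = l1dist n x y"
  shows "geod n X x y"
proof -
  let ?D = "l1dist n x m" and ?E = "l1dist n m y"
  obtain f where f: "f 0 = x" "f ?D = m" "\<forall>t\<in>{0..?D}. f t \<in> X"
    "\<forall>t\<in>{0..?D}. \<forall>t'\<in>{0..?D}. l1dist n (f t) (f t') = \<bar>t - t'\<bar>"
    using xm unfolding geod_def by blast
  obtain g where g: "g 0 = m" "g ?E = y" "\<forall>t\<in>{0..?E}. g t \<in> X"
    "\<forall>t\<in>{0..?E}. \<forall>t'\<in>{0..?E}. l1dist n (g t) (g t') = \<bar>t - t'\<bar>"
    using my unfolding geod_def by blast
  define h where "h t = (if t \<le> ?D then f t else g (t - ?D))" for t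
  have h0: "h 0 = x" using f by (simp add: h_def)
  have h1: "h (l1dist n x y) = y"
  proof (cases "?E = 0")
    case True
    then have "l1dist n x y = ?D" using btw by simp
    then show ?thesis using f g True by (simp add: h_def)
  next
    case False
    then have "\<not> l1dist n x y \<le> ?D" using btw l1dist_nonneg[of n m y] by linarith
    moreover have "l1dist n x y - ?D = ?E" using btw by simp
    ultimately show ?thesis using g by (simp add: h_def)
  qed
  have hX: "h t \<in> X" if "t \<in> {0..l1dist n x y}" for t
    using that f(3) g(3) btw by (auto simp: h_def)
  have key: "l1dist n (h t) (h t') = t' - t" if "0 \<le> t" "t \<le> t'" "t' \<le> l1dist n x y" for t t'
  proof -
    consider "t' \<le> ?D" | "t \<le> ?D" "t' > ?D" | "t > ?D" using that by linarith
    then show ?thesis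
    proof cases
      case 1 then show ?thesis using f that by (auto simp: h_def)
    next
      case 3 then show ?thesis using g that btw by (auto simp: h_def)
    next
      case 2
      have a: "l1dist n x (f t) = t" using f(1,4) 2 that by (metis abs_of_nonneg abs_minus_commute atLeastAtMost_iff diff_zero l1dist_nonneg order_refl)
      have b: "l1dist n (f t) m = ?D - t" using f(2,4) 2 that
        by (metis abs_of_nonneg abs_minus_commute atLeastAtMost_iff diff_ge_0_iff_ge l1dist_nonneg order_refl)
      let ?s = "t' - ?D"
      have s: "0 \<le> ?s" "?s \<le> ?E" using 2 that btw by auto
      have c: "l1dist n m (g ?s) = ?s" using g(1,4) s
        by (metis abs_of_nonneg abs_minus_commute atLeastAtMost_iff diff_zero l1dist_nonneg order_refl)
      have d: "l1dist n (g ?s) y = ?E - ?s" using g(2,4) s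
        by (metis abs_of_nonneg abs_minus_commute atLeastAtMost_iff diff_ge_0_iff_ge l1dist_nonneg order_refl)
      \<comment> \<open>The upper bound goes through \<open>m\<close>; the lower bound compares the
        route from \<open>x\<close> to \<open>y\<close> via \<open>f t\<close> and
        \<open>g ?s\<close> with the full length.\<close>
      have "l1dist n (f t) (g ?s) = t' - t"
        using a b c d btw l1dist_triangle[of n "f t" "g ?s" m] l1dist_triangle[of n x y "f t"]
          l1dist_triangle[of n "f t" y "g ?s"] by linarith
      then show ?thesis using 2 by (simp add: h_def)
    qed
  qed
  have "l1dist n (h t) (h t') = \<bar>t - t'\<bar>" if "t \<in> {0..l1dist n x y}" "t' \<in> {0..l1dist n x y}" for t t'
    using key[of t t'] key[of t' t] that l1dist_commute[of n "h t" "h t'"] by (cases "t \<le> t'") auto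
  then show ?thesis unfolding geod_def using h0 h1 hX by blast
qed

text \<open>Distances add up along a path exactly when each coordinate is monotone. The parameter is
  not arc length, so that coordinates can be altered one at a time without reparametrising.\<close>

definition mono_path :: "nat \<Rightarrow> (real \<Rightarrow> nat \<Rightarrow> real) \<Rightarrow> bool" where
  "mono_path n \<beta> \<longleftrightarrow> (\<forall>j<n. continuous_on {0..1} (\<lambda>t. \<beta> t j) \<and>
     (mono_on {0..1} (\<lambda>t. \<beta> t j) \<or> antimono_on {0..1} (\<lambda>t. \<beta> t j)))"

text \<open>By monotonicity the distance between two points of the path is the difference of their
  distances \<open>s\<close> from the start, so any right inverse of \<open>s\<close> is an arc
  length parametrisation.\<close>

lemma geodI:
  assumes X: "X \<subseteq> Rn n" and b: "mono_path n \<beta>" and bX: "\<And>t. 0 \<le> t \<Longrightarrow> t \<le> 1 \<Longrightarrow> \<beta> t \<in> X"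
  shows "geod n X (\<beta> 0) (\<beta> 1)"
proof -
  let ?D = "l1dist n (\<beta> 0) (\<beta> 1)"
  define s where "s t = l1dist n (\<beta> 0) (\<beta> t)" for t
  have cont: "continuous_on {0..1} s"
    unfolding s_def l1dist_def using b by (intro continuous_intros) (auto simp: mono_path_def)
  have dist: "l1dist n (\<beta> t) (\<beta> t') = s t' - s t" if "0 \<le> t" "t \<le> t'" "t' \<le> 1" for t t'
  proof -
    have "\<bar>\<beta> t j - \<beta> t' j\<bar> = \<bar>\<beta> 0 j - \<beta> t' j\<bar> - \<bar>\<beta> 0 j - \<beta> t j\<bar>" if j: "j < n" for j
    proof -
      have "mono_on {0..1} (\<lambda>t. \<beta> t j) \<or> antimono_on {0..1} (\<lambda>t. \<beta> t j)"
        using b j by (auto simp: mono_path_def)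
      then show ?thesis
      proof
        assume "mono_on {0..1} (\<lambda>t. \<beta> t j)"
        then have "\<beta> 0 j \<le> \<beta> t j" "\<beta> t j \<le> \<beta> t' j"
          using \<open>0 \<le> t\<close> \<open>t \<le> t'\<close> \<open>t' \<le> 1\<close> by (auto simp: monotone_on_def)
        then show ?thesis by linarith
      next
        assume "antimono_on {0..1} (\<lambda>t. \<beta> t j)"
        then have "\<beta> 0 j \<ge> \<beta> t j" "\<beta> t j \<ge> \<beta> t' j"
          using \<open>0 \<le> t\<close> \<open>t \<le> t'\<close> \<open>t' \<le> 1\<close> by (auto simp: monotone_on_def)
        then show ?thesis by linarith
      qed
    qed
    then show ?thesis by (simp add: s_def l1dist_def sum_subtractf)
  qed
  have ex: "\<exists>t. 0 \<le> t \<and> t \<le> 1 \<and> s t = u" if "u \<in> {0..?D}" for u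
    using IVT'[of s 0 u 1] cont that by (auto simp: s_def)
  \<comment> \<open>\<open>s\<close> may be constant on intervals, so a preimage is chosen; the two
    end values are fixed by hand because the geodesic must start and stop at the given points. If
    \<open>?D = 0\<close> the first branch wins, hence the separate case in
    \<open>end1\<close>.\<close>
  define \<tau> where "\<tau> u = (if u = 0 then 0 else if u = ?D then 1 else SOME t. 0 \<le> t \<and> t \<le> 1 \<and> s t = u)" for u
  have tau: "0 \<le> \<tau> u \<and> \<tau> u \<le> 1 \<and> s (\<tau> u) = u" if "u \<in> {0..?D}" for u
    using someI_ex[OF ex[OF that]] by (simp add: \<tau>_def) (simp add: s_def)
  have end1: "\<beta> (\<tau> ?D) = \<beta> 1"
  proof (cases "?D = 0")
    case True
    then have "\<beta> 0 = \<beta> 1" using l1dist_eq_0[of "\<beta> 0" n "\<beta> 1"] bX[of 0] bX[of 1] X by auto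
    then show ?thesis by (simp add: \<tau>_def)
  qed (simp add: \<tau>_def)
  have "l1dist n (\<beta> (\<tau> u)) (\<beta> (\<tau> u')) = \<bar>u - u'\<bar>" if "u \<in> {0..?D}" "u' \<in> {0..?D}" for u u'
  proof (cases "\<tau> u \<le> \<tau> u'")
    case True
    have "l1dist n (\<beta> (\<tau> u)) (\<beta> (\<tau> u')) = u' - u" using dist[of "\<tau> u" "\<tau> u'"] True tau that by auto
    then show ?thesis using l1dist_nonneg[of n "\<beta> (\<tau> u)" "\<beta> (\<tau> u')"] by linarith
  next
    case False
    then have "l1dist n (\<beta> (\<tau> u')) (\<beta> (\<tau> u)) = u - u'" using dist[of "\<tau> u'" "\<tau> u"] tau that by auto
    then show ?thesis using l1dist_nonneg[of n "\<beta> (\<tau> u')" "\<beta> (\<tau> u)"]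
      by (subst l1dist_commute) linarith
  qed
  moreover have "\<tau> 0 = 0" by (simp add: \<tau>_def)
  ultimately show ?thesis unfolding geod_def
    using end1 tau bX by (intro exI[of _ "\<lambda>u. \<beta> (\<tau> u)"]) auto
qed

text \<open>Ordered points on a geodesic satisfy the triangle inequality with equality, hence do so
  in each coordinate, and betweenness of real values is monotonicity.\<close>

lemma geodE:
  assumes "geod n X x y"
  obtains \<beta> where "mono_path n \<beta>" "\<beta> 0 = x" "\<beta> 1 = y" "\<And>t. 0 \<le> t \<Longrightarrow> t \<le> 1 \<Longrightarrow> \<beta> t \<in> X"
proof -
  let ?D = "l1dist n x y"
  obtain \<gamma> where g: "\<gamma> 0 = x" "\<gamma> ?D = y" "\<forall>t\<in>{0..?D}. \<gamma> t \<in> X"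
    "\<forall>t\<in>{0..?D}. \<forall>t'\<in>{0..?D}. l1dist n (\<gamma> t) (\<gamma> t') = \<bar>t - t'\<bar>"
    using assms unfolding geod_def by blast
  define \<beta> where "\<beta> t = \<gamma> (t * ?D)" for t
  have in01: "t * ?D \<in> {0..?D}" if "0 \<le> t" "t \<le> 1" for t
    using that by (auto simp: mult_left_le_one_le)
  have d: "l1dist n (\<beta> t) (\<beta> t') = \<bar>t - t'\<bar> * ?D" if "0 \<le> t" "t \<le> 1" "0 \<le> t'" "t' \<le> 1" for t t'
    using g(4) in01[OF that(1,2)] in01[OF that(3,4)]
    by (simp add: \<beta>_def left_diff_distrib[symmetric] abs_mult)
  have ends: "\<beta> 0 = x" "\<beta> 1 = y" using g by (auto simp: \<beta>_def)
  have cont: "continuous_on {0..1} (\<lambda>t. \<beta> t j)" if "j < n" for j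
  proof (rule lipschitz_on_continuous_on, rule lipschitz_onI)
    show "dist (\<beta> t j) (\<beta> t' j) \<le> ?D * dist t t'" if "t \<in> {0..1}" "t' \<in> {0..1}" for t t'
      using coord_le_l1dist[OF \<open>j < n\<close>, of "\<beta> t" "\<beta> t'"] d[of t t'] that
      by (simp add: dist_real_def mult.commute)
  qed simp
  have btw: "\<bar>x j - \<beta> s j\<bar> + \<bar>\<beta> s j - \<beta> t j\<bar> + \<bar>\<beta> t j - y j\<bar> = \<bar>x j - y j\<bar>"
    if st: "0 \<le> s" "s \<le> t" "t \<le> 1" and j: "j < n" for s t j
  proof -
    have "l1dist n x (\<beta> s) + l1dist n (\<beta> s) (\<beta> t) = l1dist n x (\<beta> t)"
      using d[of 0 s] d[of s t] d[of 0 t] st by (simp add: ends algebra_simps)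
    moreover have "l1dist n x (\<beta> t) + l1dist n (\<beta> t) y = l1dist n x y"
      using d[of 0 t] d[of t 1] st by (simp add: ends algebra_simps)
    ultimately show ?thesis using l1dist_additive_coord j by (metis (no_types, lifting))
  qed
  have "mono_path n \<beta>"
    unfolding mono_path_def
  proof (intro allI impI conjI cont)
    fix j assume j: "j < n"
    show "mono_on {0..1} (\<lambda>t. \<beta> t j) \<or> antimono_on {0..1} (\<lambda>t. \<beta> t j)"
    proof (cases "x j \<le> y j")
      case True
      have "mono_on {0..1} (\<lambda>t. \<beta> t j)"
        by (rule monotone_onI) (use btw j True in fastforce)
      then show ?thesis ..
    next
      case False
      have "antimono_on {0..1} (\<lambda>t. \<beta> t j)"
        by (rule monotone_onI) (use btw j False in fastforce)
      then show ?thesis ..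
    qed
  qed
  then show ?thesis using that[of \<beta>] ends g(3) in01 by (auto simp: \<beta>_def)
qed

section \<open>Spreading a set along a coordinate\<close>

text \<open>Bounds that depend on the old coordinate allow pulling a set to a wall and thickening
  it; constant bounds give flattening and cylinders. One convexity proof serves all four.\<close>

definition spread :: "nat \<Rightarrow> (real \<Rightarrow> real) \<Rightarrow> (real \<Rightarrow> real) \<Rightarrow> (nat \<Rightarrow> real) set \<Rightarrow> (nat \<Rightarrow> real) set" where
  "spread i lo hi X = {x(i := y) |x y. x \<in> X \<and> lo (x i) \<le> y \<and> y \<le> hi (x i)}"

lemma spread_iff: "z \<in> spread i lo hi X \<longleftrightarrow> (\<exists>x\<in>X. \<exists>y. z = x(i := y) \<and> lo (x i) \<le> y \<and> y \<le> hi (x i))"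
  by (auto simp: spread_def)

lemma spreadI: "x \<in> X \<Longrightarrow> lo (x i) \<le> y \<Longrightarrow> y \<le> hi (x i) \<Longrightarrow> x(i := y) \<in> spread i lo hi X"
  by (auto simp: spread_def)

lemma continuous_on_fun_upd [continuous_intros]:
  fixes f :: "'a::topological_space \<Rightarrow> 'b \<Rightarrow> 'c::topological_space"
  assumes "continuous_on A f" "continuous_on A g"
  shows "continuous_on A (\<lambda>t. (f t)(i := g t))"
proof (rule continuous_on_coordinatewise_then_product)
  fix j show "continuous_on A (\<lambda>t. ((f t)(i := g t)) j)"
    using assms continuous_on_product_then_coordinatewise[OF assms(1), of j] by (cases "j = i") auto
qed

text \<open>A parameter in \<open>[0,1]\<close> interpolating between the two bounds exhibits the
  set as a continuous image of \<open>X \<times> {0..1}\<close>.\<close>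

lemma compact_spread:
  assumes "compact X" "continuous_on UNIV lo" "continuous_on UNIV hi" "\<And>t. lo t \<le> hi t"
  shows "compact (spread i lo hi X)"
proof -
  let ?g = "\<lambda>(x::nat\<Rightarrow>real, u). x(i := (1 - u) * lo (x i) + u * hi (x i))"
  have c: "continuous_on A (\<lambda>p::(nat \<Rightarrow> real) \<times> real. fst p i)" for A
    by (rule continuous_on_product_then_coordinatewise) (intro continuous_intros)
  have "continuous_on (X \<times> {0..1}) ?g"
    unfolding case_prod_unfold
    by (intro continuous_intros continuous_on_compose2[OF assms(2)] continuous_on_compose2[OF assms(3)] c) auto
  then have "compact (?g ` (X \<times> {0..1}))"
    by (intro compact_continuous_image compact_Times assms) auto
  moreover have "?g ` (X \<times> {0..1}) = spread i lo hi X"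
  proof (intro equalityI subsetI)
    fix z assume "z \<in> ?g ` (X \<times> {0..1})"
    then obtain x u where xu: "x \<in> X" "0 \<le> u" "u \<le> 1" "z = x(i := (1 - u) * lo (x i) + u * hi (x i))" by auto
    have "(1 - u) * lo (x i) + u * hi (x i) \<in> closed_segment (lo (x i)) (hi (x i))"
      using xu by (auto simp: closed_segment_def)
    then show "z \<in> spread i lo hi X"
      unfolding xu(4) using xu(1) assms(4)[of "x i"] by (intro spreadI) (auto simp: closed_segment_eq_real_ivl)
  next
    fix z assume "z \<in> spread i lo hi X"
    then obtain x y where xy: "x \<in> X" "z = x(i := y)" "lo (x i) \<le> y" "y \<le> hi (x i)" by (auto simp: spread_iff)
    then have "y \<in> closed_segment (lo (x i)) (hi (x i))" by (auto simp: closed_segment_eq_real_ivl)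
    then obtain u where "0 \<le> u" "u \<le> 1" "y = (1 - u) * lo (x i) + u * hi (x i)"
      by (auto simp: closed_segment_def)
    then show "z \<in> ?g ` (X \<times> {0..1})" using xy by (auto intro!: image_eqI[of _ _ "(x,u)"])
  qed
  ultimately show ?thesis by simp
qed

lemma mono_path_upd:
  assumes "mono_path n \<beta>" "continuous_on {0..1} m" "mono_on {0..1} m \<or> antimono_on {0..1} m"
  shows "mono_path n (\<lambda>t. (\<beta> t)(i := m t))"
  unfolding mono_path_def
proof (intro allI impI)
  fix j assume "j < n"
  then show "continuous_on {0..1} (\<lambda>t. ((\<beta> t)(i := m t)) j) \<and>
    (mono_on {0..1} (\<lambda>t. ((\<beta> t)(i := m t)) j) \<or> antimono_on {0..1} (\<lambda>t. ((\<beta> t)(i := m t)) j))"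
    using assms by (cases "j = i") (auto simp: mono_path_def)
qed

lemma mono_path_const: "mono_path n (\<lambda>_. x)"
  by (simp add: mono_path_def monotone_on_def)

lemma mono_path_coord_const:
  assumes "mono_path n \<beta>" "j < n" "\<beta> 0 j = \<beta> 1 j" "0 \<le> t" "t \<le> 1"
  shows "\<beta> t j = \<beta> 0 j"
proof -
  have "mono_on {0..1} (\<lambda>t. \<beta> t j) \<or> antimono_on {0..1} (\<lambda>t. \<beta> t j)"
    using assms by (auto simp: mono_path_def)
  then show ?thesis using assms(3-5) unfolding monotone_on_def
    by (metis atLeastAtMost_iff order_antisym order_refl zero_le_one)
qed

lemma Rn_upd: "x \<in> Rn n \<Longrightarrow> i < n \<Longrightarrow> x(i := y) \<in> Rn n"
  by (auto simp: Rn_def)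

lemma spread_subset_Rn: "X \<subseteq> Rn n \<Longrightarrow> i < n \<Longrightarrow> spread i lo hi X \<subseteq> Rn n"
  using Rn_upd by (force simp: spread_iff)

lemma geod_coord_move:
  assumes X: "X \<subseteq> Rn n" and i: "i < n" and seg: "\<And>y. y \<in> closed_segment a b \<Longrightarrow> x(i := y) \<in> X"
  shows "geod n X (x(i := a)) (x(i := b))"
proof -
  let ?b = "\<lambda>t. x(i := a + t * (b - a))"
  have "mono_on {0..1} (\<lambda>t. a + t * (b - a)) \<or> antimono_on {0..1} (\<lambda>t. a + t * (b - a))"
    by (cases "a \<le> b") (auto simp: monotone_on_def mult_right_mono mult_right_mono_neg)
  then have "mono_path n ?b"
    by (intro mono_path_upd mono_path_const continuous_intros)
  moreover have "?b t \<in> X" if "0 \<le> t" "t \<le> 1" for t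
    by (rule seg) (use that in \<open>auto simp: closed_segment_def algebra_simps intro!: exI[of _ t]\<close>)
  ultimately show ?thesis using geodI[OF X, of ?b] by simp
qed

text \<open>A monotone path between the base points is lifted by pushing its \<open>i\<close>-th coordinate up just far
  enough to stay above \<open>lo\<close>; what is then missing in coordinate \<open>i\<close> is made up by a final
  axis-parallel move.\<close>

lemma l1convex_spread:
  assumes Rn: "X \<subseteq> Rn n" and X: "l1convex n X" and i: "i < n"
    and lo: "mono lo" "continuous_on UNIV lo" and hi: "mono hi"
    and le: "\<And>t. lo t \<le> hi t"
  shows "l1convex n (spread i lo hi X)"
proof -
  let ?E = "spread i lo hi X"
  have ERn: "?E \<subseteq> Rn n" using Rn i by (rule spread_subset_Rn)
  have main: "geod n ?E p p'" if p: "p \<in> ?E" and p': "p' \<in> ?E" and pp: "p i \<le> p' i" for p p'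
  proof -
    obtain x where x: "x \<in> X" "p = x(i := p i)" "lo (x i) \<le> p i" "p i \<le> hi (x i)"
      using p by (auto simp: spread_iff)
    obtain x' where x': "x' \<in> X" "p' = x'(i := p' i)" "lo (x' i) \<le> p' i" "p' i \<le> hi (x' i)"
      using p' by (auto simp: spread_iff)
    obtain \<beta> where b: "mono_path n \<beta>" "\<beta> 0 = x" "\<beta> 1 = x'" "\<And>t. 0 \<le> t \<Longrightarrow> t \<le> 1 \<Longrightarrow> \<beta> t \<in> X"
      using X x(1) x'(1) unfolding l1convex_geod by (metis geodE)
    define m where "m t = max (p i) (lo (\<beta> t i))" for t
    let ?\<delta> = "\<lambda>t. (\<beta> t)(i := m t)"
    have bi: "continuous_on {0..1} (\<lambda>t. \<beta> t i)"
      "mono_on {0..1} (\<lambda>t. \<beta> t i) \<or> antimono_on {0..1} (\<lambda>t. \<beta> t i)"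
      using b(1) i by (auto simp: mono_path_def)
    have m_hi: "m t \<le> hi (\<beta> t i)" and anti: "antimono_on {0..1} (\<lambda>t. \<beta> t i) \<Longrightarrow> m t = p i"
      if t: "0 \<le> t" "t \<le> 1" for t
    proof -
      \<comment> \<open>An increasing coordinate inherits the bound from the start \<open>x\<close>;
        for a decreasing one it comes from the far end \<open>x'\<close>, and there the assumption
        \<open>p i \<le> p' i\<close> enters.\<close>
      have p_hi: "p i \<le> hi (\<beta> t i)"
        using bi(2)
      proof
        assume "mono_on {0..1} (\<lambda>t. \<beta> t i)"
        then have "\<beta> 0 i \<le> \<beta> t i" using t by (auto simp: monotone_on_def)
        then show ?thesis using hi x(4) b(2) by (auto dest: monoD intro: order_trans)
      next
        assume "antimono_on {0..1} (\<lambda>t. \<beta> t i)"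
        then have "\<beta> 1 i \<le> \<beta> t i" using t by (auto simp: monotone_on_def)
        then show ?thesis using hi x'(4) pp b(3) by (meson monoD order_trans)
      qed
      then show "m t \<le> hi (\<beta> t i)" using le by (simp add: m_def)
      assume "antimono_on {0..1} (\<lambda>t. \<beta> t i)"
      then have "\<beta> t i \<le> \<beta> 0 i" using t by (auto simp: monotone_on_def)
      then have "lo (\<beta> t i) \<le> p i" using lo(1) x(3) b(2) by (meson monoD order_trans)
      then show "m t = p i" by (simp add: m_def)
    qed
    have "continuous_on {0..1} m" unfolding m_def
      by (intro continuous_intros continuous_on_compose2[OF lo(2) bi(1)]) auto
    moreover have "mono_on {0..1} m"
      using bi(2)
    proof
      assume "mono_on {0..1} (\<lambda>t. \<beta> t i)"
      then show ?thesis using lo(1) unfolding monotone_on_def m_def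
        by (meson UNIV_I max.mono order_refl)
    next
      assume "antimono_on {0..1} (\<lambda>t. \<beta> t i)"
      then show ?thesis using anti by (auto simp: monotone_on_def)
    qed
    ultimately have "mono_path n ?\<delta>"
      using b(1) by (intro mono_path_upd) auto
    moreover have "?\<delta> t \<in> ?E" if "0 \<le> t" "t \<le> 1" for t
      using b(4)[OF that] m_hi[OF that] by (intro spreadI) (auto simp: m_def)
    ultimately have "geod n ?E (?\<delta> 0) (?\<delta> 1)" using geodI[OF ERn, of ?\<delta>] by blast
    moreover have "?\<delta> 0 = p" using x(2,3) b(2) by (simp add: m_def max_absorb1)
    ultimately have g1: "geod n ?E p (?\<delta> 1)" by simp
    have m1: "m 1 = max (p i) (lo (x' i))" using b(3) by (simp add: m_def)
    have g2: "geod n ?E (x'(i := m 1)) (x'(i := p' i))"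
    proof (rule geod_coord_move[OF ERn i])
      fix y assume "y \<in> closed_segment (m 1) (p' i)"
      moreover have "m 1 \<le> p' i" using x'(3) pp m1 by simp
      ultimately have "m 1 \<le> y" "y \<le> p' i" by (auto simp: closed_segment_eq_real_ivl)
      then show "x'(i := y) \<in> ?E" using x' m1 by (intro spreadI) auto
    qed
    have "l1dist n p (?\<delta> 1) + l1dist n (?\<delta> 1) p' = l1dist n p p'"
    proof -
      have "\<bar>p j - ?\<delta> 1 j\<bar> + \<bar>?\<delta> 1 j - p' j\<bar> = \<bar>p j - p' j\<bar>" for j
      proof (cases "j = i")
        case True
        then show ?thesis using m1 x'(3) pp by auto
      next
        case False
        then have "p' j = x' j" using x'(2) by (metis fun_upd_apply)
        then show ?thesis using b(3) False by simp
      qed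
      then show ?thesis unfolding l1dist_def sum.distrib[symmetric] by simp
    qed
    then show ?thesis using geod_trans[OF g1] g2 b(3) x'(2) by simp
  qed
  show ?thesis unfolding l1convex_geod
    using main geod_sym by (metis linear)
qed

lemma Cn_spread:
  assumes "X \<in> Cn n" "i < n" "mono lo" "continuous_on UNIV lo" "mono hi" "continuous_on UNIV hi" "\<And>t. lo t \<le> hi t"
  shows "spread i lo hi X \<in> Cn n"
  using assms l1convex_spread[of X n i lo hi] compact_spread[of X lo hi i]
    spread_subset_Rn[of X n i lo hi] by (simp add: Cn_iff)

text \<open>Composition with a monotone function in each coordinate turns monotone paths into
  monotone paths. It serves to set unwanted coordinates to 0.\<close>

lemma Cn_coordwise_image:
  assumes X: "X \<in> Cn n" and c: "\<And>j. j < n \<Longrightarrow> continuous_on UNIV (f j)"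
    and m: "\<And>j. j < n \<Longrightarrow> mono (f j) \<or> antimono (f j)" and z: "\<And>j. n \<le> j \<Longrightarrow> f j = (\<lambda>_. 0)"
  shows "(\<lambda>x j. f j (x j)) ` X \<in> Cn n"
proof -
  let ?F = "\<lambda>x j. f j (x j)"
  have c': "continuous_on UNIV (f j)" for j using c[of j] z[of j] by (cases "j < n") auto
  have "continuous_on X ?F"
    by (rule continuous_on_coordinatewise_then_product, rule continuous_on_compose2[OF c'])
      (auto intro: continuous_on_subset[OF continuous_on_product_coordinates])
  then have comp: "compact (?F ` X)" using CnD(2)[OF X] by (rule compact_continuous_image)
  have R: "?F ` X \<subseteq> Rn n" using z by (auto simp: Rn_def)
  have "geod n (?F ` X) (?F x) (?F y)" if xy: "x \<in> X" "y \<in> X" for x y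
  proof -
    obtain \<beta> where b: "mono_path n \<beta>" "\<beta> 0 = x" "\<beta> 1 = y" "\<And>t. 0 \<le> t \<Longrightarrow> t \<le> 1 \<Longrightarrow> \<beta> t \<in> X"
      using CnD(3)[OF X] xy unfolding l1convex_geod by (metis geodE)
    have "mono_path n (\<lambda>t. ?F (\<beta> t))"
      unfolding mono_path_def
    proof (intro allI impI conjI)
      fix j assume j: "j < n"
      show "continuous_on {0..1} (\<lambda>t. f j (\<beta> t j))"
        using b(1) j by (intro continuous_on_compose2[OF c']) (auto simp: mono_path_def)
      show "mono_on {0..1} (\<lambda>t. f j (\<beta> t j)) \<or> antimono_on {0..1} (\<lambda>t. f j (\<beta> t j))"
        using b(1) j m[OF j] unfolding mono_path_def monotone_on_def
        by (metis UNIV_I)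
    qed
    then have "geod n (?F ` X) (?F (\<beta> 0)) (?F (\<beta> 1))" using b(4) by (intro geodI R) auto
    then show ?thesis using b by simp
  qed
  then show ?thesis using comp R by (auto simp: Cn_iff l1convex_geod)
qed

section \<open>Boxes and star-shaped sets\<close>

definition RI :: "nat set \<Rightarrow> (nat \<Rightarrow> real) set" where
  "RI I = {x. \<forall>j. j \<notin> I \<longrightarrow> x j = 0}"

lemma RI_lessThan: "RI {..<n} = Rn n" by (auto simp: RI_def Rn_def)

lemma RI_mono: "I \<subseteq> J \<Longrightarrow> RI I \<subseteq> RI J" by (auto simp: RI_def)

text \<open>The corners are opposite but not ordered, so any point can be the corner towards which
  other boxes are drawn.\<close>

definition lbox :: "(nat \<Rightarrow> real) \<Rightarrow> (nat \<Rightarrow> real) \<Rightarrow> (nat \<Rightarrow> real) set" where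
  "lbox a b = {y. \<forall>j. y j \<in> closed_segment (a j) (b j)}"

lemma lbox_ends [simp]: "a \<in> lbox a b" "b \<in> lbox a b" by (auto simp: lbox_def)

lemma lbox_subset_RI: "a \<in> RI I \<Longrightarrow> b \<in> RI I \<Longrightarrow> lbox a b \<subseteq> RI I"
  unfolding lbox_def RI_def by (smt (verit) closed_segment_idem mem_Collect_eq singletonD subsetI)

lemma geod_lbox:
  assumes X: "X \<subseteq> Rn n" and box: "lbox x y \<subseteq> X"
  shows "geod n X x y"
proof -
  let ?b = "\<lambda>t j. x j + t * (y j - x j)"
  have "mono_on {0..1} (\<lambda>t. ?b t j) \<or> antimono_on {0..1} (\<lambda>t. ?b t j)" for j
    by (cases "x j \<le> y j") (auto simp: monotone_on_def mult_right_mono mult_right_mono_neg)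
  then have "mono_path n ?b"
    unfolding mono_path_def by (auto intro!: continuous_intros)
  moreover have "?b t \<in> X" if "0 \<le> t" "t \<le> 1" for t
  proof -
    have "?b t \<in> lbox x y" using that
      by (auto simp: lbox_def closed_segment_def algebra_simps intro!: exI[of _ t])
    then show ?thesis using box by auto
  qed
  ultimately show ?thesis using geodI[OF X, of ?b] by simp
qed

text \<open>The median of three reals.\<close>

definition med :: "real \<Rightarrow> real \<Rightarrow> real \<Rightarrow> real" where
  "med a b c = max (min a b) (min (max a b) c)"

text \<open>For points of \<open>Rn n\<close>, \<open>lbox x w\<close> is the union of all l1
  geodesics from \<open>x\<close> to \<open>w\<close>, so this is star-shapedness with segments
  replaced by geodesics.\<close>

definition star_to :: "(nat \<Rightarrow> real) \<Rightarrow> (nat \<Rightarrow> real) set \<Rightarrow> bool" where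
  "star_to w X \<longleftrightarrow> (\<forall>x\<in>X. lbox x w \<subseteq> X)"

text \<open>In each coordinate two segments with a common end \<open>c\<close> meet in the segment
  from the median of the three ends to \<open>c\<close>.\<close>

lemma lbox_Int_lbox: "lbox a w \<inter> lbox b w = lbox (\<lambda>j. med (a j) (b j) (w j)) w"
proof -
  have "y \<in> closed_segment a w \<and> y \<in> closed_segment b w \<longleftrightarrow> y \<in> closed_segment (med a b w) w" for y a b w :: real
    by (auto simp: med_def closed_segment_eq_real_ivl split: if_splits)
  then show ?thesis unfolding lbox_def by blast
qed

text \<open>The coordinatewise median of \<open>x\<close>, \<open>y\<close> and \<open>w\<close>
  lies between \<open>x\<close> and \<open>y\<close>, and the boxes joining it to \<open>x\<close>
  and to \<open>y\<close> lie in the boxes towards \<open>w\<close>, hence in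
  \<open>X\<close>.\<close>

lemma l1convex_star_to:
  assumes X: "X \<subseteq> Rn n" and st: "star_to w X"
  shows "l1convex n X"
  unfolding l1convex_geod
proof (intro ballI)
  fix x y assume xy: "x \<in> X" "y \<in> X"
  let ?m = "\<lambda>j. med (x j) (y j) (w j)"
  have m: "med a b c \<in> closed_segment a c" "med a b c \<in> closed_segment a b" "med a b c \<in> closed_segment b c" for a b c
    by (auto simp: med_def closed_segment_eq_real_ivl)
  have sub: "closed_segment a b \<subseteq> closed_segment a c" if "b \<in> closed_segment a c" for a b c :: real
    using that by (simp add: subset_closed_segment)
  have "lbox x ?m \<subseteq> lbox x w" "lbox y ?m \<subseteq> lbox y w"
    unfolding lbox_def using sub m by blast+
  then have "geod n X x ?m" "geod n X ?m y"
    using st xy by (auto simp: star_to_def intro!: geod_lbox X geod_sym[of n X y])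
  moreover have "l1dist n x ?m + l1dist n ?m y = l1dist n x y"
  proof -
    have "\<bar>x j - ?m j\<bar> + \<bar>?m j - y j\<bar> = \<bar>x j - y j\<bar>" for j
      unfolding med_def by linarith
    then show ?thesis unfolding l1dist_def sum.distrib[symmetric] by simp
  qed
  ultimately show "geod n X x y" by (rule geod_trans)
qed

lemma star_to_lbox: "star_to w (lbox a w)"
  by (auto simp: star_to_def lbox_def closed_segment_eq_real_ivl split: if_splits) (smt (verit))+

lemma star_to_UN: "(\<And>a. a \<in> F \<Longrightarrow> star_to w (X a)) \<Longrightarrow> star_to w (\<Union>a\<in>F. X a)"
  by (force simp: star_to_def)

lemma compact_lbox: "compact (lbox a b)"
proof -
  have "lbox a b = PiE UNIV (\<lambda>j. closed_segment (a j) (b j))" by (auto simp: lbox_def)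
  moreover have "compactin (product_topology (\<lambda>_. euclidean) UNIV) (PiE UNIV (\<lambda>j. closed_segment (a j) (b j)))"
    by (subst compactin_PiE) (auto simp: compactin_euclidean_iff)
  ultimately show ?thesis by (simp add: euclidean_product_topology[symmetric] compactin_euclidean_iff[symmetric])
qed

section \<open>Valuations vanishing on boxes\<close>

text \<open>Hausdorff closeness without suprema and infima; it differs from \<open>hdist\<close>
  only in strictness, which continuity does not detect.\<close>

definition near :: "nat \<Rightarrow> real \<Rightarrow> (nat \<Rightarrow> real) set \<Rightarrow> (nat \<Rightarrow> real) set \<Rightarrow> bool" where
  "near n r X Y \<longleftrightarrow> (\<forall>x\<in>X. \<exists>y\<in>Y. l1dist n x y \<le> r) \<and> (\<forall>y\<in>Y. \<exists>x\<in>X. l1dist n x y \<le> r)"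

lemma hdist_le_of_near:
  assumes "X \<noteq> {}" "Y \<noteq> {}" "near n r X Y"
  shows "hdist n X Y \<le> r"
  unfolding hdist_def
proof (intro max.boundedI cSUP_least assms(1,2))
  have bdd: "bdd_below ((\<lambda>y. l1dist n (f y) (g y)) ` A)" for f g and A :: "(nat \<Rightarrow> real) set"
    by (rule bdd_belowI2[of _ 0]) simp
  show "(INF y\<in>Y. l1dist n x y) \<le> r" if x: "x \<in> X" for x
  proof -
    obtain y where "y \<in> Y" "l1dist n x y \<le> r" using assms(3) x by (auto simp: near_def)
    then show ?thesis using bdd[of "\<lambda>_. x" "\<lambda>y. y"] by (intro cINF_lower2) auto
  qed
  show "(INF x\<in>X. l1dist n x y) \<le> r" if y: "y \<in> Y" for y
  proof -
    obtain x where "x \<in> X" "l1dist n x y \<le> r" using assms(3) y by (auto simp: near_def)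
    then show ?thesis using bdd[of "\<lambda>x. x" "\<lambda>_. y"] by (intro cINF_lower2) auto
  qed
qed

text \<open>Compactness bounds the distances from \<open>X\<close> to one point of \<open>Y\<close>,
  so that the supremum really is an upper bound.\<close>

lemma SUP_INF_l1dist_lessD:
  assumes "compact X" "Y \<noteq> {}" "(SUP x\<in>X. INF y\<in>Y. l1dist n x y) < r" "x \<in> X"
  shows "\<exists>y\<in>Y. l1dist n x y < r"
proof -
  have bdd: "bdd_below (l1dist n x ` Y)" for x
    by (rule bdd_belowI2[of _ 0]) simp
  obtain y0 where y0: "y0 \<in> Y" using assms(2) by blast
  have "compact ((\<lambda>x. l1dist n x y0) ` X)"
    by (intro compact_continuous_image continuous_intros assms)
  then have "bdd_above ((\<lambda>x. l1dist n x y0) ` X)"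
    by (intro bounded_imp_bdd_above compact_imp_bounded)
  then obtain B where B: "\<And>x. x \<in> X \<Longrightarrow> l1dist n x y0 \<le> B" by (auto simp: bdd_above_def)
  have "bdd_above ((\<lambda>x. INF y\<in>Y. l1dist n x y) ` X)"
    by (rule bdd_aboveI2[of _ _ B], rule order_trans[OF cINF_lower[OF bdd y0] B])
  then have "(INF y\<in>Y. l1dist n x y) \<le> (SUP x\<in>X. INF y\<in>Y. l1dist n x y)"
    using assms(4) by (rule cSUP_upper2) simp
  then have "(INF y\<in>Y. l1dist n x y) < r" using assms(3) by linarith
  then show ?thesis using cINF_less_iff[OF assms(2) bdd] by blast
qed

lemma near_of_hdist_less:
  assumes "compact X" "compact Y" "X \<noteq> {}" "Y \<noteq> {}" "hdist n X Y < r"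
  shows "near n r X Y"
proof -
  have 1: "(SUP x\<in>X. INF y\<in>Y. l1dist n x y) < r" and "(SUP y\<in>Y. INF x\<in>X. l1dist n x y) < r"
    using assms(5) by (auto simp: hdist_def)
  then have 2: "(SUP y\<in>Y. INF x\<in>X. l1dist n y x) < r" by (simp add: l1dist_commute)
  have "\<forall>x\<in>X. \<exists>y\<in>Y. l1dist n x y \<le> r"
    using SUP_INF_l1dist_lessD[OF assms(1,4) 1] by (auto intro: less_imp_le)
  moreover have "\<forall>y\<in>Y. \<exists>x\<in>X. l1dist n x y \<le> r"
    using SUP_INF_l1dist_lessD[OF assms(2,3) 2] by (subst l1dist_commute) (auto intro: less_imp_le)
  ultimately show ?thesis by (simp add: near_def)
qed

lemma hcontinuous_near:
  "hcontinuous n \<phi> \<longleftrightarrow> (\<forall>X\<in>Cn n - {{}}. \<forall>\<epsilon>>0. \<exists>\<delta>>0. \<forall>Y\<in>Cn n - {{}}.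
      near n \<delta> X Y \<longrightarrow> \<bar>\<phi> Y - \<phi> X\<bar> < \<epsilon>)"
proof -
  have "(\<exists>\<delta>>0. \<forall>Y\<in>Cn n - {{}}. hdist n X Y < \<delta> \<longrightarrow> \<bar>\<phi> Y - \<phi> X\<bar> < \<epsilon>) \<longleftrightarrow>
      (\<exists>\<delta>>0. \<forall>Y\<in>Cn n - {{}}. near n \<delta> X Y \<longrightarrow> \<bar>\<phi> Y - \<phi> X\<bar> < \<epsilon>)" (is "?L \<longleftrightarrow> ?R")
    if X: "X \<in> Cn n - {{}}" for X \<epsilon>
  proof
    assume ?L
    then obtain d where d: "d > 0" "\<And>Y. Y \<in> Cn n - {{}} \<Longrightarrow> hdist n X Y < d \<Longrightarrow> \<bar>\<phi> Y - \<phi> X\<bar> < \<epsilon>" by blast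
    \<comment> \<open>\<open>near\<close> only yields a weak inequality; halving makes it
      strict.\<close>
    have "\<bar>\<phi> Y - \<phi> X\<bar> < \<epsilon>" if "Y \<in> Cn n - {{}}" "near n (d/2) X Y" for Y
      using d hdist_le_of_near[of X Y n "d/2"] that X by fastforce
    then show ?R using d(1) by (intro exI[of _ "d/2"]) auto
  next
    assume ?R
    then obtain d where d: "d > 0" "\<And>Y. Y \<in> Cn n - {{}} \<Longrightarrow> near n d X Y \<Longrightarrow> \<bar>\<phi> Y - \<phi> X\<bar> < \<epsilon>" by blast
    then show ?L using near_of_hdist_less[of X _ n d] X by (intro exI[of _ d]) (auto dest: CnD(2))
  qed
  then show ?thesis unfolding hcontinuous_def by (auto simp del: Diff_iff)
qed

section \<open>Functionals that vanish on the boxes of a coordinate subspace\<close>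

definition CI :: "nat \<Rightarrow> nat set \<Rightarrow> (nat \<Rightarrow> real) set set" where
  "CI n I = {X \<in> Cn n. X \<subseteq> RI I}"

text \<open>The hypotheses of the vanishing theorem in a form inherited by the cylinder functional.
  The ambient \<open>n\<close> stays fixed and only the active coordinates \<open>I\<close> shrink,
  so the induction never changes the space.\<close>

definition box_null :: "nat \<Rightarrow> nat set \<Rightarrow> ((nat \<Rightarrow> real) set \<Rightarrow> real) \<Rightarrow> bool" where
  "box_null n I \<phi> \<longleftrightarrow> \<phi> {} = 0 \<and>
     (\<forall>X Y. X \<in> CI n I \<longrightarrow> Y \<in> CI n I \<longrightarrow> X \<union> Y \<in> CI n I \<longrightarrow> X \<inter> Y \<in> CI n I \<longrightarrow>
        \<phi> (X \<union> Y) = \<phi> X + \<phi> Y - \<phi> (X \<inter> Y)) \<and>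
     (\<forall>X\<in>CI n I - {{}}. \<forall>\<epsilon>>0. \<exists>\<delta>>0. \<forall>Y\<in>CI n I - {{}}. near n \<delta> X Y \<longrightarrow> \<bar>\<phi> Y - \<phi> X\<bar> < \<epsilon>) \<and>
     (\<forall>a\<in>RI I. \<forall>b\<in>RI I. \<phi> (lbox a b) = 0)"

lemma box_nullD:
  assumes "box_null n I \<phi>"
  shows "\<phi> {} = 0"
    and "\<lbrakk>X \<in> CI n I; Y \<in> CI n I; X \<union> Y \<in> CI n I; X \<inter> Y \<in> CI n I\<rbrakk> \<Longrightarrow> \<phi> (X \<union> Y) = \<phi> X + \<phi> Y - \<phi> (X \<inter> Y)"
    and "\<lbrakk>a \<in> RI I; b \<in> RI I\<rbrakk> \<Longrightarrow> \<phi> (lbox a b) = 0"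
  using assms by (simp_all add: box_null_def)

lemma box_null_cont:
  assumes "box_null n I \<phi>" "X \<in> CI n I" "X \<noteq> {}" "\<epsilon> > 0"
  obtains \<delta> where "\<delta> > 0" "\<And>Y. Y \<in> CI n I \<Longrightarrow> Y \<noteq> {} \<Longrightarrow> near n \<delta> X Y \<Longrightarrow> \<bar>\<phi> Y - \<phi> X\<bar> < \<epsilon>"
proof -
  have "\<forall>\<epsilon>>0. \<exists>\<delta>>0. \<forall>Y\<in>CI n I - {{}}. near n \<delta> X Y \<longrightarrow> \<bar>\<phi> Y - \<phi> X\<bar> < \<epsilon>"
    using assms(1-3) by (simp add: box_null_def)
  then obtain \<delta> where "\<delta> > 0" "\<forall>Y\<in>CI n I - {{}}. near n \<delta> X Y \<longrightarrow> \<bar>\<phi> Y - \<phi> X\<bar> < \<epsilon>"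
    using assms(4) by meson
  then show ?thesis by (intro that[of \<delta>]) auto
qed

lemma spread_Un: "spread i lo hi (X \<union> Y) = spread i lo hi X \<union> spread i lo hi Y"
  unfolding spread_def by blast

lemma spreadE:
  assumes "z \<in> spread i lo hi X"
  obtains x where "x \<in> X" "z = x(i := z i)" "lo (x i) \<le> z i" "z i \<le> hi (x i)"
  using assms by (auto simp: spread_iff)

lemma spread_mono: "X \<subseteq> Y \<Longrightarrow> spread i lo hi X \<subseteq> spread i lo hi Y"
  unfolding spread_def by blast

lemma spread_const_spread_const:
  "spread i (\<lambda>_. a) (\<lambda>_. b) (spread i (\<lambda>_. c) (\<lambda>_. c) X) = spread i (\<lambda>_. a) (\<lambda>_. b) X" (is "?L = ?R")
proof (intro equalityI subsetI)
  fix z assume "z \<in> ?L"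
  then obtain x where "x \<in> X" "z = (x(i := c))(i := z i)" "a \<le> z i" "z i \<le> b"
    by (elim spreadE) (metis order_antisym)
  then show "z \<in> ?R" by (auto simp: spread_iff)
next
  fix z assume "z \<in> ?R"
  then obtain x where x: "x \<in> X" "z = x(i := z i)" "a \<le> z i" "z i \<le> b"
    by (elim spreadE)
  then have "(x(i := c))(i := z i) \<in> ?L" by (intro spreadI) auto
  then show "z \<in> ?L" using x by simp
qed

lemma spread_empty [simp]: "spread i lo hi {} = {}"
  by (auto simp: spread_iff)

lemma l1dist_upd_le: "l1dist n (x(i := t)) (y(i := t)) \<le> l1dist n x y"
  unfolding l1dist_def by (rule sum_mono) auto

text \<open>Forming cylinders respects unions, \<open>near\<close> and boxes. It respects
  intersections because a base point in \<open>RI (I - {i})\<close> is recovered from any point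
  above it by setting coordinate \<open>i\<close> to 0.\<close>

lemma box_null_cylinder:
  assumes \<phi>: "box_null n I \<phi>" and I: "I \<subseteq> {..<n}" and i: "i \<in> I" and ab: "a \<le> b"
  shows "box_null n (I - {i}) (\<lambda>Z. \<phi> (spread i (\<lambda>_. a) (\<lambda>_. b) Z))"
proof -
  let ?E = "spread i (\<lambda>_. a) (\<lambda>_. b)"
  have i0: "x i = 0" if "x \<in> X" "X \<subseteq> RI (I - {i})" for x X using that by (auto simp: RI_def)
  have E_CI: "?E X \<in> CI n I" if "X \<in> CI n (I - {i})" for X
  proof -
    have "?E X \<in> Cn n"
      by (rule Cn_spread) (use that I i ab in \<open>auto simp: CI_def monotone_on_def\<close>)
    then show ?thesis using that i by (force simp: CI_def spread_iff RI_def)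
  qed
  have E_Int: "?E (X \<inter> Y) = ?E X \<inter> ?E Y" if "X \<subseteq> RI (I - {i})" "Y \<subseteq> RI (I - {i})" for X Y
  proof
    show "?E X \<inter> ?E Y \<subseteq> ?E (X \<inter> Y)"
    proof
      fix z assume "z \<in> ?E X \<inter> ?E Y"
      then obtain x y where xy: "x \<in> X" "y \<in> Y" "z = x(i := z i)" "z = y(i := z i)" "a \<le> z i" "z i \<le> b"
        by (blast elim: spreadE)
      then have "x = z(i := 0)" "y = z(i := 0)" using i0 that by (metis fun_upd_triv fun_upd_upd)+
      then show "z \<in> ?E (X \<inter> Y)" using xy by (auto simp: spread_iff intro!: bexI[of _ x] exI[of _ "z i"])
    qed
  qed (intro Int_greatest spread_mono Int_lower1 Int_lower2)
  have E_near: "near n r (?E X) (?E Y)" if "near n r X Y" for r X Y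
    unfolding near_def
  proof (intro conjI ballI)
    fix z assume "z \<in> ?E X"
    then obtain x t where x: "x \<in> X" "z = x(i := t)" "a \<le> t" "t \<le> b" by (auto simp: spread_iff)
    then obtain y where "y \<in> Y" "l1dist n x y \<le> r" using \<open>near n r X Y\<close> by (auto simp: near_def)
    then show "\<exists>y\<in>?E Y. l1dist n z y \<le> r"
      using x l1dist_upd_le[of n x i t y] by (intro bexI[of _ "y(i := t)"]) (auto intro: spreadI)
  next
    fix z assume "z \<in> ?E Y"
    then obtain y t where x: "y \<in> Y" "z = y(i := t)" "a \<le> t" "t \<le> b" by (auto simp: spread_iff)
    then obtain x where "x \<in> X" "l1dist n x y \<le> r" using \<open>near n r X Y\<close> by (auto simp: near_def)
    then show "\<exists>x\<in>?E X. l1dist n x z \<le> r"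
      using x l1dist_upd_le[of n x i t y] by (intro bexI[of _ "x(i := t)"]) (auto intro: spreadI)
  qed
  have E_ne: "?E X \<noteq> {}" if "X \<noteq> {}" for X
    using that ab spreadI[of _ X "\<lambda>_. a" i a "\<lambda>_. b"] by blast
  have E_box: "?E (lbox p q) = lbox (p(i := a)) (q(i := b))" if "p \<in> RI (I - {i})" "q \<in> RI (I - {i})" for p q
  proof (intro equalityI subsetI)
    fix z assume "z \<in> ?E (lbox p q)"
    then obtain x where x: "x \<in> lbox p q" "z = x(i := z i)" "a \<le> z i" "z i \<le> b"
      by (elim spreadE)
    have "z j \<in> closed_segment ((p(i := a)) j) ((q(i := b)) j)" for j
    proof (cases "j = i")
      case True
      then show ?thesis using x(3,4) ab by (simp add: closed_segment_eq_real_ivl)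
    next
      case False
      then have "z j = x j" by (metis x(2) fun_upd_other)
      then show ?thesis using x(1) False by (simp add: lbox_def)
    qed
    then show "z \<in> lbox (p(i := a)) (q(i := b))"
      by (simp add: lbox_def)
  next
    fix z assume z: "z \<in> lbox (p(i := a)) (q(i := b))"
    have pq: "p i = 0" "q i = 0" using that by (auto simp: RI_def)
    have all: "z j \<in> closed_segment ((p(i := a)) j) ((q(i := b)) j)" for j
      using z by (simp add: lbox_def)
    have zj: "z j \<in> closed_segment (p j) (q j)" if "j \<noteq> i" for j
      using all[of j] that by simp
    have "z i \<in> closed_segment a b" using all[of i] by simp
    then have zi: "a \<le> z i" "z i \<le> b" using ab by (auto simp: closed_segment_eq_real_ivl)
    have "z(i := 0) \<in> lbox p q" using zj pq by (auto simp: lbox_def)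
    then show "z \<in> ?E (lbox p q)" using zi spreadI[of "z(i := 0)" "lbox p q" "\<lambda>_. a" i "z i" "\<lambda>_. b"] by simp
  qed
  have sub: "X \<in> CI n (I - {i}) \<Longrightarrow> X \<subseteq> RI (I - {i})" for X by (auto simp: CI_def)
  show ?thesis
    unfolding box_null_def
  proof (intro conjI allI impI ballI)
    show "\<phi> (?E {}) = 0" using \<phi> by (simp add: box_null_def)
  next
    fix X Y assume a: "X \<in> CI n (I - {i})" "Y \<in> CI n (I - {i})" "X \<union> Y \<in> CI n (I - {i})" "X \<inter> Y \<in> CI n (I - {i})"
    then show "\<phi> (?E (X \<union> Y)) = \<phi> (?E X) + \<phi> (?E Y) - \<phi> (?E (X \<inter> Y))"
      using box_nullD(2)[OF \<phi> E_CI[OF a(1)] E_CI[OF a(2)]] E_CI[OF a(3)] E_CI[OF a(4)]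
      unfolding spread_Un E_Int[OF sub[OF a(1)] sub[OF a(2)]] by blast
  next
    fix X and \<epsilon> :: real assume a: "X \<in> CI n (I - {i}) - {{}}" "0 < \<epsilon>"
    then have "?E X \<in> CI n I" "?E X \<noteq> {}" using E_CI E_ne by auto
    then obtain d where d: "d > 0" "\<And>Y. Y \<in> CI n I \<Longrightarrow> Y \<noteq> {} \<Longrightarrow> near n d (?E X) Y \<Longrightarrow> \<bar>\<phi> Y - \<phi> (?E X)\<bar> < \<epsilon>"
      using box_null_cont[OF \<phi> _ _ a(2)] by metis
    have "\<bar>\<phi> (?E Y) - \<phi> (?E X)\<bar> < \<epsilon>" if "Y \<in> CI n (I - {i}) - {{}}" "near n d X Y" for Y
      using d(2)[of "?E Y"] E_near[OF that(2)] E_CI[of Y] E_ne[of Y] that(1) by blast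
    then show "\<exists>\<delta>>0. \<forall>Y\<in>CI n (I - {i}) - {{}}. near n \<delta> X Y \<longrightarrow> \<bar>\<phi> (?E Y) - \<phi> (?E X)\<bar> < \<epsilon>"
      using d(1) by blast
  next
    fix p q assume pq: "p \<in> RI (I - {i})" "q \<in> RI (I - {i})"
    then have "p(i := a) \<in> RI I" "q(i := b) \<in> RI I" using i by (auto simp: RI_def)
    then show "\<phi> (?E (lbox p q)) = 0" using box_nullD(3)[OF \<phi>] E_box[OF pq] by simp
  qed
qed

section \<open>Finite unions of boxes with a common corner\<close>

lemma finite_net:
  assumes "compact X" "0 < \<delta>"
  obtains F where "finite F" "F \<subseteq> X" "\<And>x. x \<in> X \<Longrightarrow> \<exists>a\<in>F. l1dist n a x < \<delta>"
proof -
  have "open {y. l1dist n a y < \<delta>}" for a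
    by (rule open_Collect_less) (intro continuous_intros)+
  moreover have "X \<subseteq> (\<Union>a\<in>X. {y. l1dist n a y < \<delta>})" using assms(2) by auto
  ultimately obtain F where "F \<subseteq> X" "finite F" "X \<subseteq> (\<Union>a\<in>F. {y. l1dist n a y < \<delta>})"
    using compactE_image[OF assms(1), of X "\<lambda>a. {y. l1dist n a y < \<delta>}"] by metis
  then show ?thesis using that[of F] by blast
qed

lemma star_CI:
  assumes "I \<subseteq> {..<n}" "X \<subseteq> RI I" "compact X" "star_to w X"
  shows "X \<in> CI n I"
proof -
  have "X \<subseteq> Rn n" using assms(1,2) RI_mono[OF assms(1)] by (simp add: RI_lessThan subset_iff)
  then show ?thesis using assms l1convex_star_to by (auto simp: CI_def Cn_iff)
qed

text \<open>Splitting off one box leaves two families of boxes with corner \<open>w\<close>: the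
  others, and their intersections with it. The second is not a subfamily but has no more members
  than the first, hence the induction on cardinality.\<close>

lemma box_null_UN_lbox:
  assumes \<phi>: "box_null n I \<phi>" and I: "I \<subseteq> {..<n}" and w: "w \<in> RI I"
  shows "finite F \<Longrightarrow> F \<subseteq> RI I \<Longrightarrow> \<phi> (\<Union>a\<in>F. lbox a w) = 0"
proof (induction "card F" arbitrary: F rule: less_induct)
  case less
  let ?U = "\<lambda>F. \<Union>a\<in>F. lbox a w"
  have U_CI: "?U F \<in> CI n I" if "finite F" "F \<subseteq> RI I" for F
  proof (rule star_CI[OF I])
    show "?U F \<subseteq> RI I" using that(2) w by (intro UN_least lbox_subset_RI) auto
    show "compact (?U F)" using that(1) by (intro compact_UN compact_lbox) auto
    show "star_to w (?U F)" by (intro star_to_UN star_to_lbox)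
  qed
  show ?case
  proof (cases "F = {}")
    case True
    then show ?thesis using \<phi> by (simp add: box_null_def)
  next
    case False
    then obtain b F' where F': "F = insert b F'" "b \<notin> F'" by (metis Set.set_insert all_not_in_conv)
    let ?G = "(\<lambda>a j. med (a j) (b j) (w j)) ` F'"
    have fin: "finite F'" "F' \<subseteq> RI I" "b \<in> RI I" using less.prems F' by auto
    have GR: "?G \<subseteq> RI I" using fin w by (auto simp: RI_def med_def)
    have card: "card F' < card F" "card ?G < card F"
      using F' fin card_image_le[OF fin(1), of "\<lambda>a j. med (a j) (b j) (w j)"] by auto
    have int: "?U F' \<inter> lbox b w = ?U ?G" using lbox_Int_lbox[of _ w b] by auto
    have un: "?U F = ?U F' \<union> lbox b w" using F' by auto
    have box: "lbox b w \<in> CI n I" using U_CI[of "{b}"] fin by simp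
    have F'': "?U F' \<union> lbox b w \<in> CI n I" "?U F' \<inter> lbox b w \<in> CI n I"
      using U_CI[OF less.prems] U_CI[OF finite_imageI[OF fin(1)] GR] unfolding int un by auto
    have "\<phi> (?U F' \<union> lbox b w) = \<phi> (?U F') + \<phi> (lbox b w) - \<phi> (?U F' \<inter> lbox b w)"
      by (rule box_nullD(2)[OF \<phi> U_CI[OF fin(1,2)] box F''])
    then have "\<phi> (?U F) = \<phi> (?U F') + \<phi> (lbox b w) - \<phi> (?U ?G)"
      unfolding int un .
    moreover have "\<phi> (?U F') = 0" "\<phi> (?U ?G) = 0"
      using less.hyps[OF card(1) fin(1,2)] less.hyps[OF card(2) finite_imageI[OF fin(1)] GR] by auto
    moreover have "\<phi> (lbox b w) = 0" by (rule box_nullD(3)[OF \<phi> fin(3) w])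
    ultimately show ?thesis by simp
  qed
qed

lemma box_null_star:
  assumes \<phi>: "box_null n I \<phi>" and I: "I \<subseteq> {..<n}" and w: "w \<in> RI I"
    and X: "X \<in> CI n I" "star_to w X"
  shows "\<phi> X = 0"
proof (cases "X = {}")
  case True then show ?thesis using \<phi> by (simp add: box_null_def)
next
  case False
  have "\<bar>\<phi> X\<bar> < \<epsilon>" if e: "\<epsilon> > 0" for \<epsilon>
  proof -
    obtain d where d: "d > 0" "\<And>Y. Y \<in> CI n I \<Longrightarrow> Y \<noteq> {} \<Longrightarrow> near n d X Y \<Longrightarrow> \<bar>\<phi> Y - \<phi> X\<bar> < \<epsilon>"
      using box_null_cont[OF \<phi> X(1) False e] by metis
    have cX: "compact X" and XR: "X \<subseteq> RI I" using X(1) by (auto simp: CI_def dest: CnD)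
    obtain F where F: "finite F" "F \<subseteq> X" "\<And>x. x \<in> X \<Longrightarrow> \<exists>a\<in>F. l1dist n a x < d"
      using finite_net[OF cX d(1)] by metis
    let ?U = "\<Union>a\<in>F. lbox a w"
    \<comment> \<open>The approximating union lies inside \<open>X\<close>, so the net is needed for
      one half of \<open>near\<close> only.\<close>
    have UX: "?U \<subseteq> X" using X(2) F(2) by (auto simp: star_to_def)
    have "?U \<noteq> {}" using F(3) False by (metis UN_I empty_iff equals0I lbox_ends(1))
    moreover have "?U \<in> CI n I"
      using UX XR F(1) by (intro star_CI[OF I, where w=w] compact_UN star_to_UN star_to_lbox compact_lbox) auto
    moreover have "near n d X ?U"
      unfolding near_def
    proof (intro conjI ballI)
      fix x assume "x \<in> X"
      then obtain a where "a \<in> F" "l1dist n a x < d" using F(3) by blast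
      then show "\<exists>y\<in>?U. l1dist n x y \<le> d"
        by (intro bexI[of _ a] UN_I[of a]) (auto simp: l1dist_commute)
    next
      fix y assume "y \<in> ?U"
      then show "\<exists>x\<in>X. l1dist n x y \<le> d" using UX d(1) by (intro bexI[of _ y]) auto
    qed
    ultimately have "\<bar>\<phi> ?U - \<phi> X\<bar> < \<epsilon>" using d(2) by blast
    moreover have "\<phi> ?U = 0" using box_null_UN_lbox[OF \<phi> I w F(1)] F(2) XR by blast
    ultimately show ?thesis by simp
  qed
  then show ?thesis by (metis abs_le_zero_iff linorder_not_less order_refl zero_less_abs_iff)
qed

text \<open>A coordinate with equal end values is constant along a monotone path, so the geodesic
  moves in direction \<open>i\<close> alone and meets every intermediate value.\<close>

lemma l1convex_line:
  assumes "X \<in> Cn n" "x \<in> X" "x(i := c) \<in> X" "i < n" "y \<in> closed_segment (x i) c"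
  shows "x(i := y) \<in> X"
proof -
  obtain \<beta> where b: "mono_path n \<beta>" "\<beta> 0 = x" "\<beta> 1 = x(i := c)" "\<And>t. 0 \<le> t \<Longrightarrow> t \<le> 1 \<Longrightarrow> \<beta> t \<in> X"
    using CnD(3)[OF assms(1)] assms(2,3) unfolding l1convex_geod by (metis geodE)
  have cont: "continuous_on {0..1} (\<lambda>t. \<beta> t i)" using b(1) assms(4) by (auto simp: mono_path_def)
  have "\<exists>t\<ge>0. t \<le> 1 \<and> \<beta> t i = y"
  proof (cases "x i \<le> c")
    case True
    then show ?thesis using IVT'[of "\<lambda>t. \<beta> t i" 0 y 1] cont assms(5) b by (auto simp: closed_segment_eq_real_ivl)
  next
    case False
    then show ?thesis using IVT2'[of "\<lambda>t. \<beta> t i" 1 y 0] cont assms(5) b by (auto simp: closed_segment_eq_real_ivl)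
  qed
  then obtain t where t: "0 \<le> t" "t \<le> 1" "\<beta> t i = y" by blast
  have "\<beta> t = x(i := y)"
  proof (rule Rn_eqI)
    show "\<beta> t \<in> Rn n" "x(i := y) \<in> Rn n" using b(4)[OF t(1,2)] assms CnD(1) Rn_upd by blast+
    fix j assume j: "j < n"
    show "\<beta> t j = (x(i := y)) j"
    proof (cases "j = i")
      case False
      then have "\<beta> 0 j = \<beta> 1 j" using b by simp
      then have "\<beta> t j = \<beta> 0 j" using mono_path_coord_const[OF b(1) j _ t(1,2)] by simp
      then show ?thesis using False b by simp
    qed (use t in simp)
  qed
  then show ?thesis using b(4)[OF t(1,2)] by simp
qed

section \<open>Pulling to the walls, one coordinate at a time\<close>

definition star_dirs :: "(nat \<Rightarrow> real) \<Rightarrow> nat set \<Rightarrow> (nat \<Rightarrow> real) set \<Rightarrow> bool" where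
  "star_dirs w J X \<longleftrightarrow> (\<forall>x\<in>X. \<forall>j\<in>J. \<forall>y\<in>closed_segment (x j) (w j). x(j := y) \<in> X)"

lemma star_to_of_dirs:
  assumes "finite I" "X \<subseteq> RI I" "w \<in> RI I" "star_dirs w I X"
  shows "star_to w X"
  unfolding star_to_def
proof (intro ballI subsetI)
  fix x y assume x: "x \<in> X" and y: "y \<in> lbox x w"
  have "(\<lambda>j. if j \<in> J then y j else x j) \<in> X" if "finite J" "J \<subseteq> I" for J
    using that
  proof (induction J rule: finite_induct)
    case empty then show ?case using x by simp
  next
    case (insert i J)
    let ?z = "\<lambda>j. if j \<in> J then y j else x j"
    have "?z \<in> X" using insert by simp
    moreover have "y i \<in> closed_segment (?z i) (w i)" using y insert by (auto simp: lbox_def)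
    ultimately have "?z(i := y i) \<in> X" using assms(4) insert.prems unfolding star_dirs_def by blast
    moreover have "?z(i := y i) = (\<lambda>j. if j \<in> insert i J then y j else x j)" by auto
    ultimately show ?case by simp
  qed
  then have "(\<lambda>j. if j \<in> I then y j else x j) \<in> X" using assms(1) by blast
  moreover have "y \<in> RI I" using lbox_subset_RI[of x I w] x y assms by blast
  then have "(\<lambda>j. if j \<in> I then y j else x j) = y" using x assms(2) by (intro HOL.ext) (auto simp: RI_def)
  ultimately show "y \<in> X" by simp
qed

lemma compact_coord_bounds:
  fixes X :: "(nat \<Rightarrow> real) set"
  assumes "compact X"
  obtains B where "0 \<le> B" "\<And>x. x \<in> X \<Longrightarrow> \<bar>x i\<bar> \<le> B"
proof -
  have "compact ((\<lambda>x. x i) ` X)"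
    by (intro compact_continuous_image continuous_on_subset[OF continuous_on_product_coordinates] assms) auto
  then have "bounded ((\<lambda>x. x i) ` X)" by (rule compact_imp_bounded)
  then obtain B where "\<And>x. x \<in> X \<Longrightarrow> \<bar>x i\<bar> \<le> B" by (auto simp: bounded_iff)
  then show ?thesis using that[of "max B 0"] by (auto simp: le_max_iff_disj)
qed

text \<open>For \<open>K\<close> in the inner induction the set is already star-shaped towards \<open>w\<close> in the directions
  outside \<open>K\<close>. Pulling it along a further direction \<open>i\<close> to the two walls \<open>B\<close> and \<open>-B\<close> gives two sets
  which meet exactly in the given one, since its fibres are intervals, and whose union is a cylinder.\<close>

theorem box_null_zero:
  assumes "finite I" "I \<subseteq> {..<n}" "box_null n I \<phi>" "X \<in> CI n I"
  shows "\<phi> X = 0"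
  using assms
proof (induction I arbitrary: \<phi> X rule: finite_psubset_induct)
  case (psubset I)
  \<comment> \<open>Set and corner are both generalised: a pull replaces the set and moves one
    coordinate of the corner to a wall.\<close>
  have "\<phi> X = 0" if "finite K" "K \<subseteq> I" "w \<in> RI I" "X \<in> CI n I" "star_dirs w (I - K) X" for K w X
    using that
  proof (induction K arbitrary: w X rule: finite_induct)
    case empty
    then show ?case
      using star_to_of_dirs[of I X w] psubset by (intro box_null_star) (auto simp: CI_def)
  next
    case (insert i K)
    have i: "i \<in> I" "i < n" using insert.prems psubset.prems by auto
    have XC: "X \<in> Cn n" and XR: "X \<subseteq> RI I" using insert.prems by (auto simp: CI_def)
    obtain B where B: "0 \<le> B" "\<And>x. x \<in> X \<Longrightarrow> \<bar>x i\<bar> \<le> B"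
      using compact_coord_bounds[OF CnD(2)[OF XC], of i] by metis
    have B': "-B \<le> x i" "x i \<le> B" if "x \<in> X" for x using B(2)[OF that] by linarith+
    let ?P = "spread i (\<lambda>t. t) (\<lambda>t. max t B) X" and ?N = "spread i (\<lambda>t. min t (-B)) (\<lambda>t. t) X"
    \<comment> \<open>Flattening coordinate \<open>i\<close> first presents \<open>?C\<close> as a
      cylinder over a set in \<open>RI (I - {i})\<close>, where the outer induction hypothesis
      applies.\<close>
    let ?Z = "spread i (\<lambda>_. 0) (\<lambda>_. 0) X"
    let ?C = "spread i (\<lambda>_. -B) (\<lambda>_. B) ?Z"
    have CI: "spread i lo hi Y \<in> CI n I"
      if "Y \<in> CI n I" "mono lo" "continuous_on UNIV lo" "mono hi" "continuous_on UNIV hi" "\<And>t. lo t \<le> hi t" for lo hi Y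
      using Cn_spread[OF _ i(2), of Y lo hi] that i(1) by (force simp: CI_def spread_iff RI_def)
    have P: "?P \<in> CI n I"
      by (rule CI[OF insert.prems(3)]) (auto intro!: continuous_intros simp: monotone_on_def)
    have N: "?N \<in> CI n I"
      by (rule CI[OF insert.prems(3)]) (auto intro!: continuous_intros simp: monotone_on_def)
    have Z: "?Z \<in> CI n I"
      by (rule CI[OF insert.prems(3)]) (auto intro!: continuous_intros simp: monotone_on_def)
    have C: "?C \<in> CI n I"
      by (rule CI[OF Z]) (use B in \<open>auto intro!: continuous_intros simp: monotone_on_def\<close>)
    have Z': "?Z \<in> CI n (I - {i})" using Z by (auto simp: CI_def spread_iff RI_def)
    have "\<phi> ?C = 0"
      by (rule psubset.IH[of "I - {i}", OF _ _ box_null_cylinder[OF psubset.prems(2) psubset.prems(1) i(1)] Z'])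
        (use i psubset.prems B in auto)
    have PN: "?P \<union> ?N = ?C"
    proof -
      have "z \<in> ?C \<longleftrightarrow> (\<exists>x\<in>X. \<exists>y. z = x(i := y) \<and> - B \<le> y \<and> y \<le> B)" for z
        unfolding spread_const_spread_const spread_iff by simp
      moreover have "z \<in> ?P \<union> ?N \<longleftrightarrow> (\<exists>x\<in>X. \<exists>y. z = x(i := y) \<and> - B \<le> y \<and> y \<le> B)" for z
      proof -
        have "(x i \<le> y \<and> y \<le> max (x i) B) \<or> (min (x i) (-B) \<le> y \<and> y \<le> x i) \<longleftrightarrow> - B \<le> y \<and> y \<le> B"
          if "x \<in> X" for x y using B'[OF that] by auto
        then show ?thesis unfolding Un_iff spread_iff by blast
      qed
      ultimately show ?thesis by blast
    qed
    have PX: "?P \<inter> ?N = X"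
    proof (intro equalityI subsetI)
      fix z assume "z \<in> ?P \<inter> ?N"
      then obtain x x' where x: "x \<in> X" "x' \<in> X" "z = x(i := z i)" "z = x'(i := z i)" "x i \<le> z i" "z i \<le> x' i"
        by (blast elim: spreadE)
      then have "x(i := x' i) = x'" by (metis fun_upd_triv fun_upd_upd)
      then show "z \<in> X" using l1convex_line[OF XC x(1), of i "x' i" "z i"] x i(2) by (auto simp: closed_segment_eq_real_ivl)
    next
      fix z assume z: "z \<in> X"
      show "z \<in> ?P \<inter> ?N"
        using z spreadI[of z X "\<lambda>t. t" i "z i" "\<lambda>t. max t B"] spreadI[of z X "\<lambda>t. min t (-B)" i "z i" "\<lambda>t. t"] by auto
    qed
    \<comment> \<open>In direction \<open>i\<close> the new fibre reaches the wall \<open>c\<close>;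
      a move in another direction commutes with the change of coordinate \<open>i\<close>, so the
      old star property survives.\<close>
    have dirs: "star_dirs (w(i := c)) (I - K) (spread i lo hi X)"
      if fib: "\<And>x y y'. x \<in> X \<Longrightarrow> lo (x i) \<le> y \<Longrightarrow> y \<le> hi (x i) \<Longrightarrow> y' \<in> closed_segment y c \<Longrightarrow> lo (x i) \<le> y' \<and> y' \<le> hi (x i)"
      for lo hi c
      unfolding star_dirs_def
    proof (intro ballI)
      fix z j v assume z: "z \<in> spread i lo hi X" and j: "j \<in> I - K" and v: "v \<in> closed_segment (z j) ((w(i := c)) j)"
      obtain x y where x: "x \<in> X" "z = x(i := y)" "lo (x i) \<le> y" "y \<le> hi (x i)" using z by (auto simp: spread_iff)
      show "z(j := v) \<in> spread i lo hi X"
      proof (cases "j = i")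
        case True
        then show ?thesis using x fib[of x y v] v by (auto intro!: spreadI)
      next
        case False
        then have "x(j := v) \<in> X" using insert.prems(4) j x v by (auto simp: star_dirs_def)
        then have "(x(j := v))(i := y) \<in> spread i lo hi X" using x False by (intro spreadI) auto
        then show ?thesis using x False by (simp add: fun_upd_twist)
      qed
    qed
    have wR: "w(i := c) \<in> RI I" for c using insert.prems(2) i by (auto simp: RI_def)
    have "\<phi> ?P = 0"
      by (rule insert.IH[OF _ wR P dirs[of _ _ B]])
        (use insert.prems B' in \<open>auto simp: closed_segment_eq_real_ivl split: if_splits dest: B'\<close>)
    moreover have "\<phi> ?N = 0"
      by (rule insert.IH[OF _ wR N dirs[of _ _ "-B"]])
        (use insert.prems B' in \<open>auto simp: closed_segment_eq_real_ivl split: if_splits dest: B'\<close>)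
    moreover have "\<phi> ?C = \<phi> ?P + \<phi> ?N - \<phi> X"
      using box_nullD(2)[OF psubset.prems(2) P N] C insert.prems(3) PN PX by simp
    ultimately show ?case using \<open>\<phi> ?C = 0\<close> by simp
  qed
  \<comment> \<open>With \<open>K = I\<close> no direction is required to be star-shaped, so any
    corner will do.\<close>
  from this[of I "\<lambda>_. 0" X] show ?case
    using psubset by (auto simp: star_dirs_def RI_def)
qed

section \<open>Volumes of projections\<close>

definition vol :: "nat set \<Rightarrow> (nat \<Rightarrow> real) set \<Rightarrow> real" where
  "vol S X = measure (PiM S (\<lambda>_. lborel)) ((\<lambda>x. restrict x S) ` X)"

lemma intrinsic_volume_vol: "intrinsic_volume n i X = (\<Sum>S\<in>{S. S \<subseteq> {..<n} \<and> card S = i}. vol S X)"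
  by (simp add: intrinsic_volume_def vol_def)

section \<open>Measurability and finiteness of projected volumes\<close>

lemma product_lborel: "product_sigma_finite (\<lambda>_::nat. lborel :: real measure)"
  by unfold_locales

lemma compact_restrict_image:
  fixes X :: "(nat \<Rightarrow> real) set"
  assumes "compact X" shows "compact ((\<lambda>x. restrict x S) ` X)"
proof (rule compact_continuous_image[OF continuous_on_coordinatewise_then_product assms])
  fix j show "continuous_on X (\<lambda>x. restrict x S j)"
    by (cases "j \<in> S") (auto intro: continuous_on_subset[OF continuous_on_product_coordinates])
qed

text \<open>Compactness refers to the topology of all functions, measurability to the product over
  \<open>S\<close>. The inclusion is measurable since coordinates outside \<open>S\<close> are
  constantly \<open>undefined\<close>.\<close>

lemma sets_PiM_compact:
  fixes K :: "(nat \<Rightarrow> real) set"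
  assumes "compact K" "K \<subseteq> extensional S"
  shows "K \<in> sets (PiM S (\<lambda>_. lborel))"
proof -
  have "(\<lambda>y. y) \<in> borel_measurable (PiM S (\<lambda>_. lborel :: real measure))"
  proof (rule measurable_coordinatewise_then_product)
    fix j show "(\<lambda>y. y j) \<in> borel_measurable (PiM S (\<lambda>_. lborel :: real measure))"
    proof (cases "j \<in> S")
      case True
      have "(\<lambda>y. y j) \<in> measurable (PiM S (\<lambda>_. lborel :: real measure)) lborel"
        by (rule measurable_component_singleton[OF True])
      then show ?thesis by simp
    next
      case False
      have "(\<lambda>y. undefined) \<in> borel_measurable (PiM S (\<lambda>_. lborel :: real measure))" by simp
      then show ?thesis
        by (rule measurable_cong[THEN iffD1, rotated])
          (use False in \<open>auto simp: space_PiM PiE_def extensional_def\<close>)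
    qed
  qed
  moreover have "K \<in> sets borel" using assms(1) by (simp add: borel_closed compact_imp_closed)
  ultimately have "(\<lambda>y. y) -` K \<inter> space (PiM S (\<lambda>_. lborel :: real measure)) \<in> sets (PiM S (\<lambda>_. lborel))"
    by (rule measurable_sets)
  moreover have "(\<lambda>y. y) -` K \<inter> space (PiM S (\<lambda>_. lborel :: real measure)) = K"
    using assms(2) by (auto simp: space_PiM PiE_def)
  ultimately show ?thesis by simp
qed

lemma restrict_image_sets:
  fixes X :: "(nat \<Rightarrow> real) set"
  assumes "compact X" shows "(\<lambda>x. restrict x S) ` X \<in> sets (PiM S (\<lambda>_. lborel))"
  by (intro sets_PiM_compact compact_restrict_image assms) auto

lemma emeasure_restrict_image_le:
  fixes X :: "(nat \<Rightarrow> real) set"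
  assumes "finite S" "0 \<le> L" "\<And>x j. x \<in> X \<Longrightarrow> \<bar>x j\<bar> \<le> L"
  shows "emeasure (PiM S (\<lambda>_. lborel)) ((\<lambda>x. restrict x S) ` X) \<le> ennreal ((2 * L) ^ card S)"
proof -
  interpret product_sigma_finite "\<lambda>_::nat. lborel :: real measure" by (rule product_lborel)
  have "(\<lambda>x. restrict x S) ` X \<subseteq> PiE S (\<lambda>_. {-L..L})"
    using assms(3) by (force simp: PiE_def abs_le_iff)
  then have "emeasure (PiM S (\<lambda>_. lborel)) ((\<lambda>x. restrict x S) ` X) \<le> emeasure (PiM S (\<lambda>_. lborel)) (PiE S (\<lambda>_. {-L..L}))"
    using assms(1) by (intro emeasure_mono sets_PiM_I_finite) auto
  also have "\<dots> = (\<Prod>j\<in>S. ennreal (2 * L))"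
    using assms by (subst emeasure_PiM) auto
  also have "\<dots> = ennreal ((2 * L) ^ card S)" using assms(2) by (simp add: ennreal_power)
  finally show ?thesis .
qed

lemma bounded_coords:
  assumes "X \<subseteq> Rn n" "compact X"
  obtains L where "1 \<le> L" "\<And>x j. x \<in> X \<Longrightarrow> \<bar>x j\<bar> \<le> L"
proof -
  have "\<exists>B\<ge>0. \<forall>x\<in>X. \<bar>x i\<bar> \<le> B" for i
    using compact_coord_bounds[OF assms(2), of i] by metis
  then obtain B where B: "\<And>i. B i \<ge> 0" "\<And>i x. x \<in> X \<Longrightarrow> \<bar>x i\<bar> \<le> B i" by metis
  have "\<bar>x j\<bar> \<le> 1 + (\<Sum>i<n. B i)" if "x \<in> X" for x j
  proof (cases "j < n")
    case True
    then have "B j \<le> (\<Sum>i<n. B i)" using B(1) by (intro member_le_sum) auto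
    then show ?thesis using B(2)[OF that, of j] by linarith
  next
    case False
    then have "x j = 0" using that assms(1) Rn_coord by (metis not_less subsetD)
    then show ?thesis using B(1) by (simp add: sum_nonneg add_nonneg_nonneg)
  qed
  then show ?thesis using that[of "1 + (\<Sum>i<n. B i)"] B(1) by (simp add: sum_nonneg)
qed

text \<open>Rules out the value 0 that \<open>measure\<close> takes by default on sets of infinite
  measure.\<close>

lemma emeasure_restrict_image_finite:
  assumes "X \<in> Cn n" "finite S"
  shows "emeasure (PiM S (\<lambda>_. lborel)) ((\<lambda>x. restrict x S) ` X) < \<infinity>"
proof -
  obtain L where L: "1 \<le> L" "\<And>x j. x \<in> X \<Longrightarrow> \<bar>x j\<bar> \<le> L"
    using bounded_coords[OF CnD(1,2)[OF assms(1)]] by metis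
  show ?thesis
    by (rule le_less_trans[OF emeasure_restrict_image_le[OF assms(2), of L]]) (use L in auto)
qed

lemma emeasure_eq_vol:
  assumes "X \<in> Cn n" "finite S"
  shows "emeasure (PiM S (\<lambda>_. lborel)) ((\<lambda>x. restrict x S) ` X) = ennreal (vol S X)"
  using emeasure_restrict_image_finite[OF assms] unfolding vol_def
  by (intro emeasure_eq_ennreal_measure) auto

lemma vol_nonneg: "0 \<le> vol S X"
  by (simp add: vol_def)

lemma vol_mono:
  assumes "X \<in> Cn n" "Y \<in> Cn n" "X \<subseteq> Y" "finite S"
  shows "vol S X \<le> vol S Y"
proof -
  have "emeasure (PiM S (\<lambda>_. lborel)) ((\<lambda>x. restrict x S) ` X) \<le> emeasure (PiM S (\<lambda>_. lborel)) ((\<lambda>x. restrict x S) ` Y)"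
    using assms by (intro emeasure_mono restrict_image_sets) (auto dest: CnD)
  then show ?thesis using assms by (simp add: emeasure_eq_vol vol_nonneg)
qed

lemma vol_le:
  assumes "X \<in> Cn n" "finite S" "0 \<le> L" "\<And>x j. x \<in> X \<Longrightarrow> \<bar>x j\<bar> \<le> L"
  shows "vol S X \<le> (2 * L) ^ card S"
  using emeasure_restrict_image_le[of S L X] assms by (simp add: emeasure_eq_vol)

section \<open>The valuation property\<close>

lemma mono_path_continuous:
  assumes "mono_path n \<beta>" "\<And>t. 0 \<le> t \<Longrightarrow> t \<le> 1 \<Longrightarrow> \<beta> t \<in> Rn n"
  shows "continuous_on {0..1} \<beta>"
proof (rule continuous_on_coordinatewise_then_product)
  fix j show "continuous_on {0..1} (\<lambda>t. \<beta> t j)"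
  proof (cases "j < n")
    case True then show ?thesis using assms(1) by (simp add: mono_path_def)
  next
    case False
    then have "continuous_on {0..1} (\<lambda>t. \<beta> t j) \<longleftrightarrow> continuous_on {0..1::real} (\<lambda>_. 0::real)"
      using assms(2) by (intro continuous_on_cong) (auto intro!: Rn_coord)
    then show ?thesis by simp
  qed
qed

text \<open>A geodesic between two points of the same fibre stays in that fibre, and it meets
  \<open>X \<inter> Y\<close> on its way from \<open>X\<close> to \<open>Y\<close>.\<close>

lemma restrict_image_Int:
  assumes X: "X \<in> Cn n" and Y: "Y \<in> Cn n" and XY: "X \<union> Y \<in> Cn n" and S: "S \<subseteq> {..<n}"
  shows "(\<lambda>x. restrict x S) ` (X \<inter> Y) = (\<lambda>x. restrict x S) ` X \<inter> (\<lambda>x. restrict x S) ` Y"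
proof (intro equalityI subsetI)
  fix p assume "p \<in> (\<lambda>x. restrict x S) ` X \<inter> (\<lambda>x. restrict x S) ` Y"
  then obtain x y where xy: "x \<in> X" "y \<in> Y" "p = restrict x S" "p = restrict y S" by auto
  have eq: "x j = y j" if "j \<in> S" for j using xy(3,4) that by (metis restrict_apply')
  obtain \<beta> where b: "mono_path n \<beta>" "\<beta> 0 = x" "\<beta> 1 = y" "\<And>t. 0 \<le> t \<Longrightarrow> t \<le> 1 \<Longrightarrow> \<beta> t \<in> X \<union> Y"
    using CnD(3)[OF XY] xy(1,2) unfolding l1convex_geod by (metis UnI1 UnI2 geodE)
  have cont: "continuous_on {0..1} \<beta>"
    using mono_path_continuous[OF b(1)] b(4) CnD(1)[OF XY] by blast
  \<comment> \<open>The times spent in \<open>X\<close> and those spent in \<open>Y\<close> form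
    nonempty closed sets covering the connected interval \<open>{0..1}\<close>, so they share a
    time.\<close>
  let ?A = "{0..1} \<inter> \<beta> -` X" and ?B = "{0..1} \<inter> \<beta> -` Y"
  have "closed ?A" "closed ?B"
    by (intro continuous_closed_preimage[OF cont] compact_imp_closed CnD(2)[OF X] CnD(2)[OF Y] closed_atLeastAtMost)+
  moreover have "{0..1} \<subseteq> ?A \<union> ?B" using b(4) by (auto dest: b(4))
  moreover have "0 \<in> ?A \<inter> {0..1}" "1 \<in> ?B \<inter> {0..1}" using b(2,3) xy by auto
  ultimately have "?A \<inter> ?B \<inter> {0..1} \<noteq> {}"
    using connected_closedD[OF connected_Icc[of "0::real" 1], of ?A ?B] by (metis empty_iff)
  then obtain t where "t \<in> ?A \<inter> ?B" by blast
  then have t: "0 \<le> t" "t \<le> 1" "\<beta> t \<in> X \<inter> Y" by auto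
  have "restrict (\<beta> t) S = p"
    unfolding xy(3)
  proof (rule restrict_ext)
    fix j assume "j \<in> S"
    then show "\<beta> t j = x j" using mono_path_coord_const[OF b(1), of j t] b(2,3) eq S t by auto
  qed
  then show "p \<in> (\<lambda>x. restrict x S) ` (X \<inter> Y)" using t(3) by blast
qed auto

text \<open>Projection commutes with unions always and with these intersections by
  \<open>restrict_image_Int\<close>, so inclusion-exclusion for measures applies.\<close>

lemma valuation_vol:
  assumes "S \<subseteq> {..<n}" shows "valuation n (vol S)"
  unfolding valuation_def
proof (intro conjI allI impI)
  show "vol S {} = 0" by (simp add: vol_def)
  fix X Y assume a: "X \<in> Cn n" "Y \<in> Cn n" "X \<union> Y \<in> Cn n" "X \<inter> Y \<in> Cn n"
  have S: "finite S" using assms finite_subset by blast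
  have fm: "(\<lambda>x. restrict x S) ` Z \<in> fmeasurable (PiM S (\<lambda>_. lborel))" if "Z \<in> Cn n" for Z
    using that emeasure_restrict_image_finite[OF that S] restrict_image_sets[OF CnD(2)[OF that]]
    by (auto intro: fmeasurableI)
  show "vol S (X \<union> Y) = vol S X + vol S Y - vol S (X \<inter> Y)"
    unfolding vol_def image_Un restrict_image_Int[OF a(1-3) assms]
    by (rule measure_Un3[OF fm[OF a(1)] fm[OF a(2)]])
qed

section \<open>Fibres, thickening and Hausdorff continuity\<close>

lemma Cn_fibre_interval:
  assumes P: "P \<in> Cn n" and i: "i < n" and ne: "p(i := y0) \<in> P"
  obtains a b where "a \<le> b" "{y. p(i := y) \<in> P} = {a..b}"
proof -
  let ?F = "{y. p(i := y) \<in> P}"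
  have cont: "continuous_on UNIV (\<lambda>y. p(i := y))" by (intro continuous_intros)
  have "closed ((\<lambda>y. p(i := y)) -` P)"
    by (rule closed_vimage[OF compact_imp_closed[OF CnD(2)[OF P]] cont])
  then have "closed ?F" by (simp add: vimage_def)
  obtain L where "\<And>x. x \<in> P \<Longrightarrow> \<bar>x i\<bar> \<le> L"
    using compact_coord_bounds[OF CnD(2)[OF P], of i] by metis
  then have "\<bar>y\<bar> \<le> L" if "y \<in> ?F" for y using that by (metis fun_upd_same mem_Collect_eq)
  then have "bounded ?F" unfolding bounded_iff by auto
  with \<open>closed ?F\<close> have comp: "compact ?F" by (simp add: compact_eq_bounded_closed)
  have "is_interval ?F"
    unfolding is_interval_1
  proof (intro ballI allI impI)
    fix a b x assume "a \<in> ?F" "b \<in> ?F" "a \<le> x \<and> x \<le> b"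
    then show "x \<in> ?F"
      using l1convex_line[OF P, of "p(i := a)" i b x] i by (auto simp: closed_segment_eq_real_ivl)
  qed
  then have "connected ?F" by (simp add: is_interval_connected_1)
  then obtain a b where "?F = {a..b}" using comp connected_compact_interval_1 by metis
  moreover from this have "y0 \<in> {a..b}" using ne by blast
  ultimately show ?thesis using that[of a b] by auto
qed

lemma emeasure_PiM_insert_fibres:
  fixes K :: "(nat \<Rightarrow> real) set"
  assumes "finite S" "i \<notin> S" "compact K" "K \<subseteq> extensional (insert i S)"
  shows "emeasure (PiM (insert i S) (\<lambda>_. lborel)) K = (\<integral>\<^sup>+ x. emeasure lborel {y. x(i := y) \<in> K} \<partial>(PiM S (\<lambda>_. lborel)))"
proof -
  interpret product_sigma_finite "\<lambda>_::nat. lborel :: real measure" by (rule product_lborel)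
  have K: "K \<in> sets (PiM (insert i S) (\<lambda>_. lborel))" by (rule sets_PiM_compact[OF assms(3,4)])
  have fib: "{y. x(i := y) \<in> K} \<in> sets lborel" for x
  proof -
    have "closed ((\<lambda>y. x(i := y)) -` K)"
      by (rule closed_vimage[OF compact_imp_closed[OF assms(3)]]) (intro continuous_intros)
    then show ?thesis by (simp add: vimage_def borel_closed)
  qed
  have "emeasure (PiM (insert i S) (\<lambda>_. lborel)) K = (\<integral>\<^sup>+ x. indicator K x \<partial>(PiM (insert i S) (\<lambda>_. lborel)))"
    using K by simp
  also have "\<dots> = (\<integral>\<^sup>+ x. (\<integral>\<^sup>+ y. indicator K (x(i := y)) \<partial>lborel) \<partial>(PiM S (\<lambda>_. lborel)))"
    using K by (intro product_nn_integral_insert assms) auto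
  also have "\<dots> = (\<integral>\<^sup>+ x. emeasure lborel {y. x(i := y) \<in> K} \<partial>(PiM S (\<lambda>_. lborel)))"
  proof (rule nn_integral_cong)
    fix x
    have "(\<integral>\<^sup>+ y. indicator K (x(i := y)) \<partial>lborel) = (\<integral>\<^sup>+ y. indicator {y. x(i := y) \<in> K} y \<partial>lborel)"
      by (intro nn_integral_cong) (auto simp: indicator_def)
    then show "(\<integral>\<^sup>+ y. indicator K (x(i := y)) \<partial>lborel) = emeasure lborel {y. x(i := y) \<in> K}"
      using fib by simp
  qed
  finally show ?thesis .
qed

abbreviation thicken :: "nat \<Rightarrow> real \<Rightarrow> (nat \<Rightarrow> real) set \<Rightarrow> (nat \<Rightarrow> real) set" where
  "thicken i \<delta> \<equiv> spread i (\<lambda>t. t - \<delta>) (\<lambda>t. t + \<delta>)"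

lemma Cn_thicken: "X \<in> Cn n \<Longrightarrow> i < n \<Longrightarrow> 0 \<le> \<delta> \<Longrightarrow> thicken i \<delta> X \<in> Cn n"
  by (rule Cn_spread) (auto intro!: continuous_intros simp: monotone_on_def)

text \<open>Fubini: every nonempty fibre in direction \<open>i\<close> is an interval, which thickening lengthens
  by \<open>2 * \<delta>\<close>.\<close>

lemma vol_thicken_insert:
  assumes X: "X \<in> Cn n" and i: "i < n" "i \<notin> S" and S: "S \<subseteq> {..<n}" and d: "0 \<le> \<delta>"
  shows "vol (insert i S) (thicken i \<delta> X) \<le> vol (insert i S) X + 2 * \<delta> * vol S X"
proof -
  let ?T = "insert i S" and ?X = "thicken i \<delta> X" and ?r = "\<lambda>S x. restrict x S :: nat \<Rightarrow> real"
  have fS: "finite S" using S finite_subset by blast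
  have X': "?X \<in> Cn n" using X i(1) d by (rule Cn_thicken)
  \<comment> \<open>The projection padded with 0 instead of \<open>undefined\<close>: in this form
    it belongs to \<open>Cn n\<close>, so its fibres are known to be intervals.\<close>
  let ?P = "(\<lambda>x j. if j \<in> ?T then x j else 0) ` X"
  have P: "?P \<in> Cn n"
  proof -
    have "(\<lambda>x j. (\<lambda>t. if j \<in> ?T then t else 0) (x j)) ` X \<in> Cn n"
    proof (rule Cn_coordwise_image[OF X])
      fix j
      show "continuous_on UNIV (\<lambda>t::real. if j \<in> ?T then t else 0)" by (cases "j \<in> ?T") auto
      show "mono (\<lambda>t::real. if j \<in> ?T then t else 0) \<or> antimono (\<lambda>t::real. if j \<in> ?T then t else 0)"
        by (simp add: monotone_on_def)
      assume "n \<le> j"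
      then have "j \<notin> ?T" using S i by auto
      then show "(\<lambda>t::real. if j \<in> ?T then t else 0) = (\<lambda>_. 0)" by simp
    qed
    then show ?thesis by simp
  qed
  have fibre: "emeasure lborel {y. x(i := y) \<in> ?r ?T ` ?X} \<le>
      emeasure lborel {y. x(i := y) \<in> ?r ?T ` X} + ennreal (2 * \<delta>) * indicator (?r S ` X) x"
    if x: "x \<in> extensional S" for x
  proof -
    let ?F = "{y. x(i := y) \<in> ?r ?T ` X}" and ?F' = "{y. x(i := y) \<in> ?r ?T ` ?X}"
    let ?x = "\<lambda>j. if j \<in> S then x j else 0"
    have iff: "x(i := y) = ?r ?T z \<longleftrightarrow> ?x(i := y) = (\<lambda>j. if j \<in> ?T then z j else 0)" for y z
      using x i(2) by (auto simp: fun_eq_iff extensional_def)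
    have F_eq: "?F = {y. ?x(i := y) \<in> ?P}" unfolding image_iff iff by simp
    \<comment> \<open>The new fibre stays within distance \<delta> of the old one. For an interval
      this adds at most \<open>2 * \<delta>\<close> to the length; for a scattered set the gain
      could be far larger.\<close>
    have near: "\<exists>u\<in>?F. \<bar>y - u\<bar> \<le> \<delta>" if y: "y \<in> ?F'" for y
    proof -
      obtain z where z: "z \<in> ?X" "x(i := y) = ?r ?T z" using y by auto
      obtain w where w: "w \<in> X" "z = w(i := z i)" "w i - \<delta> \<le> z i" "z i \<le> w i + \<delta>" using spreadE[OF z(1)] by metis
      have zj: "z j = w j" if "j \<noteq> i" for j using w(2) that by (metis fun_upd_other)
      have "(x(i := y)) i = ?r ?T z i" using z(2) by simp
      then have "y = z i" by simp
      moreover have "x(i := w i) = ?r ?T w"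
      proof
        fix j show "(x(i := w i)) j = ?r ?T w j"
          using fun_cong[OF z(2), of j] zj[of j] by (cases "j = i") (auto simp: restrict_def split: if_splits)
      qed
      ultimately show ?thesis using w by (intro bexI[of _ "w i"]) auto
    qed
    show ?thesis
    proof (cases "?F = {}")
      case True
      then have "?F' = {}" using near by blast
      then show ?thesis by simp
    next
      case False
      then obtain y0 where y0: "y0 \<in> ?F" by blast
      then obtain z where z: "z \<in> X" "x(i := y0) = ?r ?T z" by auto
      have "x = ?r S z"
      proof
        fix j show "x j = ?r S z j"
          using fun_cong[OF z(2), of j] x i(2) by (cases "j \<in> S") (auto simp: extensional_def split: if_splits)
      qed
      \<comment> \<open>Only points over the projection to \<open>S\<close> have nonempty fibres, so
        integrating the increment yields \<open>vol S X\<close>.\<close>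
      then have ind: "indicator (?r S ` X) x = (1 :: ennreal)" using z(1) by auto
      obtain a b where ab: "a \<le> b" "?F = {a..b}"
        using Cn_fibre_interval[OF P i(1), of ?x y0] y0 unfolding F_eq by blast
      have "?F' \<subseteq> {a - \<delta>..b + \<delta>}" using near unfolding ab(2) by fastforce
      then have "emeasure lborel ?F' \<le> emeasure lborel {a - \<delta>..b + \<delta>}" by (rule emeasure_mono) simp
      also have "\<dots> = ennreal (b - a) + ennreal (2 * \<delta>)"
        using ab(1) d by (simp flip: ennreal_plus)
      also have "\<dots> = emeasure lborel ?F + ennreal (2 * \<delta>) * indicator (?r S ` X) x"
        unfolding ab(2) ind using ab(1) by simp
      finally show ?thesis .
    qed
  qed
  have ext: "?r ?T ` Z \<subseteq> extensional ?T" for Z by auto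
  let ?M = "PiM S (\<lambda>_. lborel :: real measure)"
  \<comment> \<open>Needed to split the integral of a sum; the fibre lengths are section measures of
    a measurable set in the product of \<open>?M\<close> with \<open>lborel\<close>.\<close>
  have meas: "(\<lambda>x. emeasure lborel {y. x(i := y) \<in> ?r ?T ` X}) \<in> borel_measurable ?M"
  proof -
    have "?r ?T ` X \<in> sets (PiM ?T (\<lambda>_. lborel))" by (rule restrict_image_sets[OF CnD(2)[OF X]])
    then have [measurable]: "?r ?T ` X \<in> sets (PiM ?T (\<lambda>_. lborel))" .
    have "(\<lambda>(x, y). x(i := y)) \<in> measurable (?M \<Otimes>\<^sub>M lborel) (PiM ?T (\<lambda>_. lborel :: real measure))"
      by (rule measurable_add_dim)
    then have "(\<lambda>(x, y). x(i := y)) -` (?r ?T ` X) \<inter> space (?M \<Otimes>\<^sub>M lborel) \<in> sets (?M \<Otimes>\<^sub>M lborel)"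
      by (rule measurable_sets) measurable
    from lborel.measurable_emeasure_Pair[OF this]
    show ?thesis
      by (rule measurable_cong[THEN iffD1, rotated])
        (auto simp: space_pair_measure intro!: arg_cong[where f="emeasure lborel"])
  qed
  have "ennreal (vol ?T ?X) = (\<integral>\<^sup>+ x. emeasure lborel {y. x(i := y) \<in> ?r ?T ` ?X} \<partial>?M)"
    using emeasure_PiM_insert_fibres[OF fS i(2) compact_restrict_image[OF CnD(2)[OF X']] ext] emeasure_eq_vol[OF X', of ?T] fS by simp
  also have "\<dots> \<le> (\<integral>\<^sup>+ x. emeasure lborel {y. x(i := y) \<in> ?r ?T ` X} + ennreal (2 * \<delta>) * indicator (?r S ` X) x \<partial>?M)"
    by (intro nn_integral_mono fibre) (auto simp: space_PiM PiE_def)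
  also have "\<dots> = (\<integral>\<^sup>+ x. emeasure lborel {y. x(i := y) \<in> ?r ?T ` X} \<partial>?M) + ennreal (2 * \<delta>) * emeasure ?M (?r S ` X)"
    using restrict_image_sets[OF CnD(2)[OF X], of S] meas
    by (subst nn_integral_add) (auto simp: nn_integral_cmult_indicator)
  also have "\<dots> = ennreal (vol ?T X) + ennreal (2 * \<delta>) * ennreal (vol S X)"
    using emeasure_PiM_insert_fibres[OF fS i(2) compact_restrict_image[OF CnD(2)[OF X]] ext] emeasure_eq_vol[OF X] fS by simp
  also have "\<dots> = ennreal (vol ?T X + 2 * \<delta> * vol S X)"
    using d vol_nonneg by (simp add: ennreal_mult ennreal_plus)
  finally have "ennreal (vol ?T ?X) \<le> ennreal (vol ?T X + 2 * \<delta> * vol S X)" .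
  moreover have "0 \<le> vol ?T X + 2 * \<delta> * vol S X" using d vol_nonneg by simp
  ultimately show ?thesis using ennreal_le_iff by blast
qed

text \<open>If \<open>i\<close> is not in \<open>S\<close> the projection is unchanged. Otherwise
  the increment is a volume inside a cube of side \<open>2 * L\<close>, and
  \<open>1 \<le> 2 * L\<close> permits the uniform exponent \<open>n\<close>.\<close>

lemma vol_thicken_le:
  assumes X: "X \<in> Cn n" and i: "i < n" and S: "S \<subseteq> {..<n}" and d: "0 \<le> \<delta>"
    and L: "1 \<le> 2 * L" "\<And>x j. x \<in> X \<Longrightarrow> \<bar>x j\<bar> \<le> L"
  shows "vol S (thicken i \<delta> X) \<le> vol S X + 2 * \<delta> * (2 * L) ^ n"
proof (cases "i \<in> S")
  case True
  let ?S = "S - {i}"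
  have fS: "finite ?S" using S finite_subset by blast
  have "card ?S \<le> card {..<n}" using S by (intro card_mono) auto
  have "vol ?S X \<le> (2 * L) ^ card ?S" using X fS L by (intro vol_le) auto
  also have "\<dots> \<le> (2 * L) ^ n" using L(1) \<open>card ?S \<le> card {..<n}\<close> by (intro power_increasing) auto
  finally have "2 * \<delta> * vol ?S X \<le> 2 * \<delta> * (2 * L) ^ n" using d by (intro mult_left_mono) auto
  moreover have "vol (insert i ?S) (thicken i \<delta> X) \<le> vol (insert i ?S) X + 2 * \<delta> * vol ?S X"
    by (rule vol_thicken_insert) (use X i S d in auto)
  moreover have "insert i ?S = S" using True by auto
  ultimately show ?thesis by simp
next
  case False
  have "(\<lambda>x. restrict x S) ` thicken i \<delta> X = (\<lambda>x. restrict x S) ` X"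
  proof (intro equalityI subsetI)
    fix p assume "p \<in> (\<lambda>x. restrict x S) ` thicken i \<delta> X"
    then obtain x y where "x \<in> X" "p = restrict (x(i := y)) S" by (auto simp: spread_iff)
    then show "p \<in> (\<lambda>x. restrict x S) ` X" using False by (auto intro!: image_eqI[of _ _ x] restrict_ext)
  next
    fix p assume "p \<in> (\<lambda>x. restrict x S) ` X"
    then obtain x where x: "x \<in> X" "p = restrict x S" by auto
    have "x(i := x i) \<in> thicken i \<delta> X" using x d by (intro spreadI) auto
    then show "p \<in> (\<lambda>x. restrict x S) ` thicken i \<delta> X" using x by auto
  qed
  then show ?thesis using d L(1) by (simp add: vol_def)
qed

text \<open>For nonnegative \<delta> this is the Minkowski sum with a cube in the first
  \<open>k\<close> coordinates. A cube is taken rather than an l1 ball because it can be added one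
  coordinate at a time.\<close>

fun fatten :: "real \<Rightarrow> nat \<Rightarrow> (nat \<Rightarrow> real) set \<Rightarrow> (nat \<Rightarrow> real) set" where
  "fatten \<delta> 0 X = X"
| "fatten \<delta> (Suc k) X = thicken k \<delta> (fatten \<delta> k X)"

lemma Cn_fatten: "X \<in> Cn n \<Longrightarrow> 0 \<le> \<delta> \<Longrightarrow> k \<le> n \<Longrightarrow> fatten \<delta> k X \<in> Cn n"
  by (induction k) (auto intro: Cn_thicken)

text \<open>The second clause carries the induction: coordinate \<open>k\<close> is untouched before
  its own step, so displacements do not accumulate.\<close>

lemma fattenD:
  assumes "x \<in> fatten \<delta> k X" "0 \<le> \<delta>"
  shows "\<exists>z\<in>X. \<forall>j. \<bar>x j - z j\<bar> \<le> \<delta> \<and> (k \<le> j \<longrightarrow> x j = z j)"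
  using assms(1)
proof (induction k arbitrary: x)
  case 0
  then show ?case using assms(2) by (intro bexI[of _ x]) auto
next
  case (Suc k)
  obtain w where w: "w \<in> fatten \<delta> k X" "x = w(k := x k)" "w k - \<delta> \<le> x k" "x k \<le> w k + \<delta>"
    by (rule spreadE[OF Suc.prems[unfolded fatten.simps]])
  obtain z where z: "z \<in> X" "\<And>j. \<bar>w j - z j\<bar> \<le> \<delta>" "\<And>j. k \<le> j \<Longrightarrow> w j = z j" using Suc.IH[OF w(1)] by blast
  have wj: "x j = w j" if "j \<noteq> k" for j using w(2) that by (metis fun_upd_other)
  have "\<bar>x j - z j\<bar> \<le> \<delta> \<and> (Suc k \<le> j \<longrightarrow> x j = z j)" for j
    using wj[of j] w(3,4) z(2)[of j] z(3)[of j] by (cases "j = k") auto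
  then show ?case using z(1) by blast
qed

lemma fattenI:
  assumes "z \<in> X" "X \<subseteq> Rn n" "y \<in> Rn n" "\<And>j. j < n \<Longrightarrow> \<bar>y j - z j\<bar> \<le> \<delta>"
  shows "y \<in> fatten \<delta> n X"
proof -
  have "(\<lambda>j. if j < k then y j else z j) \<in> fatten \<delta> k X" if "k \<le> n" for k
    using that
  proof (induction k)
    case 0 then show ?case using assms(1) by simp
  next
    case (Suc k)
    let ?w = "\<lambda>j. if j < k then y j else z j"
    have "?w \<in> fatten \<delta> k X" using Suc by simp
    then have "?w(k := y k) \<in> fatten \<delta> (Suc k) X"
      unfolding fatten.simps by (rule spreadI) (use assms(4)[of k] Suc.prems in \<open>auto simp: abs_le_iff\<close>)
    moreover have "?w(k := y k) = (\<lambda>j. if j < Suc k then y j else z j)" by (auto simp: less_Suc_eq)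
    ultimately show ?case by simp
  qed
  then have "(\<lambda>j. if j < n then y j else z j) \<in> fatten \<delta> n X" by simp
  moreover have "(\<lambda>j. if j < n then y j else z j) = y"
  proof
    fix j show "(if j < n then y j else z j) = y j"
      using assms(1-3) Rn_coord[of z n j] Rn_coord[of y n j] by (cases "j < n") auto
  qed
  ultimately show ?thesis by simp
qed

text \<open>All intermediate sets lie in the cube of half-side \<open>M\<close>, so each step costs
  at most the same amount.\<close>

lemma vol_fatten_le:
  assumes X: "X \<in> Cn n" and S: "S \<subseteq> {..<n}" and d: "0 \<le> \<delta>" and L: "\<And>x j. x \<in> X \<Longrightarrow> \<bar>x j\<bar> \<le> L"
    and M: "1 \<le> 2 * M" "L + \<delta> \<le> M"
  shows "k \<le> n \<Longrightarrow> vol S (fatten \<delta> k X) \<le> vol S X + real k * (2 * \<delta> * (2 * M) ^ n)"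
proof (induction k)
  case 0 then show ?case by simp
next
  case (Suc k)
  have "vol S (thicken k \<delta> (fatten \<delta> k X)) \<le> vol S (fatten \<delta> k X) + 2 * \<delta> * (2 * M) ^ n"
  proof (rule vol_thicken_le[OF Cn_fatten[OF X d] _ S d M(1)])
    fix x j assume "x \<in> fatten \<delta> k X"
    then obtain z where "z \<in> X" "\<bar>x j - z j\<bar> \<le> \<delta>" using fattenD[OF _ d] by blast
    then show "\<bar>x j\<bar> \<le> M" using L[of z j] M(2) by linarith
  qed (use Suc.prems in auto)
  then show ?case using Suc by (simp add: algebra_simps)
qed

lemma near_sym: "near n r X Y \<longleftrightarrow> near n r Y X"
  unfolding near_def by (auto simp: l1dist_commute)

lemma near_subset_fatten:
  assumes "near n \<delta> X Y" "X \<subseteq> Rn n" "Y \<subseteq> Rn n"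
  shows "Y \<subseteq> fatten \<delta> n X"
proof
  fix y assume y: "y \<in> Y"
  then obtain x where "x \<in> X" "l1dist n x y \<le> \<delta>" using assms(1) by (auto simp: near_def)
  then show "y \<in> fatten \<delta> n X"
    using coord_le_l1dist[of _ n y x] y assms l1dist_commute[of n x y]
    by (intro fattenI[of x]) (auto intro: order_trans)
qed

text \<open>Each of two close sets lies in the fattening of the other, so monotonicity of volume
  bounds the difference from both sides.\<close>

lemma hcontinuous_vol:
  assumes S: "S \<subseteq> {..<n}" shows "hcontinuous n (vol S)"
  unfolding hcontinuous_near
proof (intro ballI allI impI)
  fix X and \<epsilon> :: real assume X: "X \<in> Cn n - {{}}" and e: "0 < \<epsilon>"
  have fS: "finite S" using S finite_subset by blast
  have XC: "X \<in> Cn n" using X by blast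
  obtain L where L: "1 \<le> L" "\<And>x j. x \<in> X \<Longrightarrow> \<bar>x j\<bar> \<le> L"
    using bounded_coords[OF CnD(1,2)[OF XC]] by metis
  \<comment> \<open>\<open>Y\<close> varies with coordinates bounded by \<open>L + 1\<close>, and
    fattening adds at most 1 more. \<open>K\<close> collects the cost of \<open>n\<close>
    thickenings per unit of \<delta>.\<close>
  define M where "M = L + 2"
  define K where "K = real n * (2 * (2 * M) ^ n)"
  have K: "0 \<le> K" using L by (simp add: K_def M_def)
  \<comment> \<open>The cap 1 keeps \<open>M\<close> valid; \<open>K + 1\<close> avoids dividing by
    0 when \<open>n = 0\<close>.\<close>
  define \<delta> where "\<delta> = min 1 (\<epsilon> / (K + 1))"
  have d: "0 < \<delta>" "\<delta> \<le> 1" "K * \<delta> < \<epsilon>"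
  proof -
    show "0 < \<delta>" "\<delta> \<le> 1" using K e by (auto simp: \<delta>_def)
    have "K * \<delta> \<le> K * (\<epsilon> / (K + 1))" using K by (intro mult_left_mono) (auto simp: \<delta>_def)
    also have "\<dots> < \<epsilon>" using K e by (simp add: field_simps)
    finally show "K * \<delta> < \<epsilon>" .
  qed
  have "\<bar>vol S Y - vol S X\<bar> < \<epsilon>" if Y: "Y \<in> Cn n - {{}}" and XY: "near n \<delta> X Y" for Y
  proof -
    have YC: "Y \<in> Cn n" using Y by blast
    have sub: "Y \<subseteq> fatten \<delta> n X" "X \<subseteq> fatten \<delta> n Y"
      using near_subset_fatten XY near_sym CnD(1) XC YC by blast+
    have LY: "\<bar>y j\<bar> \<le> L + 1" if "y \<in> Y" for y j
    proof -
      have "y \<in> fatten \<delta> n X" using sub(1) that by blast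
      from fattenD[OF this less_imp_le[OF d(1)]] obtain z where "z \<in> X" "\<bar>y j - z j\<bar> \<le> \<delta>"
        by blast
      then show ?thesis using L(2)[of z j] d(2) by linarith
    qed
    have "vol S Y \<le> vol S (fatten \<delta> n X)"
      using d by (intro vol_mono[OF YC _ sub(1) fS] Cn_fatten XC) auto
    also have "\<dots> \<le> vol S X + K * \<delta>"
      using vol_fatten_le[OF XC S, of \<delta> L M n] L(2) d L(1) by (simp add: M_def K_def algebra_simps)
    finally have 1: "vol S Y \<le> vol S X + K * \<delta>" .
    have "vol S X \<le> vol S (fatten \<delta> n Y)"
      using d by (intro vol_mono[OF XC _ sub(2) fS] Cn_fatten YC) auto
    also have "\<dots> \<le> vol S Y + K * \<delta>"
      using vol_fatten_le[OF YC S, of \<delta> "L + 1" M n] LY d L(1) by (simp add: M_def K_def algebra_simps)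
    finally show ?thesis using 1 d(3) by linarith
  qed
  then show "\<exists>\<delta>>0. \<forall>Y\<in>Cn n - {{}}. near n \<delta> X Y \<longrightarrow> \<bar>vol S Y - vol S X\<bar> < \<epsilon>"
    using d(1) by blast
qed

section \<open>Isometries\<close>

definition axis_pt :: "nat \<Rightarrow> real \<Rightarrow> nat \<Rightarrow> real" where
  "axis_pt i t = (\<lambda>j. if j = i then t else 0)"

lemma axis_pt_Rn [simp]: "i < n \<Longrightarrow> axis_pt i t \<in> Rn n"
  by (auto simp: axis_pt_def Rn_def)

lemma l1dist_upd_self: "i < n \<Longrightarrow> l1dist n x (x(i := v)) = \<bar>x i - v\<bar>"
proof -
  assume i: "i < n"
  have "l1dist n x (x(i := v)) = (\<Sum>j<n. if j = i then \<bar>x i - v\<bar> else 0)"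
    unfolding l1dist_def by (rule sum.cong) auto
  then show ?thesis using i by simp
qed

lemma l1dist_axis_pt:
  assumes "i < n"
  shows "l1dist n x (axis_pt i t) = (\<Sum>j\<in>{..<n} - {i}. \<bar>x j\<bar>) + \<bar>x i - t\<bar>"
proof -
  have "l1dist n x (axis_pt i t) = \<bar>x i - t\<bar> + (\<Sum>j\<in>{..<n} - {i}. \<bar>x j - axis_pt i t j\<bar>)"
    using assms unfolding l1dist_def by (subst sum.remove[of _ i]) (auto simp: axis_pt_def)
  also have "(\<Sum>j\<in>{..<n} - {i}. \<bar>x j - axis_pt i t j\<bar>) = (\<Sum>j\<in>{..<n} - {i}. \<bar>x j\<bar>)"
    by (rule sum.cong) (auto simp: axis_pt_def)
  finally show ?thesis by simp
qed

lemma l1dist_axis_pt_same: "i < n \<Longrightarrow> l1dist n (axis_pt i s) (axis_pt i t) = \<bar>s - t\<bar>"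
  by (subst l1dist_axis_pt) (auto simp: axis_pt_def)

lemma l1dist_axis_pt_other:
  assumes "i < n" "k < n" "i \<noteq> k"
  shows "l1dist n (axis_pt k s) (axis_pt i t) = \<bar>s\<bar> + \<bar>t\<bar>"
proof -
  have "(\<Sum>j\<in>{..<n} - {i}. \<bar>axis_pt k s j\<bar>) = (\<Sum>j\<in>{..<n} - {i}. if j = k then \<bar>s\<bar> else 0)"
    by (rule sum.cong) (auto simp: axis_pt_def)
  also have "\<dots> = \<bar>s\<bar>" using assms by simp
  finally show ?thesis using assms by (subst l1dist_axis_pt) (auto simp: axis_pt_def)
qed

text \<open>A metric stand-in for differing in at most one coordinate. Only distances occur in it,
  so isometries preserve it.\<close>

definition unique_geodesic :: "nat \<Rightarrow> (nat \<Rightarrow> real) \<Rightarrow> (nat \<Rightarrow> real) \<Rightarrow> bool" where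
  "unique_geodesic n x y \<longleftrightarrow> (\<forall>z\<in>Rn n. \<forall>w\<in>Rn n.
     l1dist n x z + l1dist n z y = l1dist n x y \<longrightarrow> l1dist n x w + l1dist n w y = l1dist n x y \<longrightarrow>
     l1dist n x z = l1dist n x w \<longrightarrow> z = w)"

lemma unique_geodesic_isometry:
  assumes g: "l1isometry n g" and "x \<in> Rn n" "y \<in> Rn n" "unique_geodesic n x y"
  shows "unique_geodesic n (g x) (g y)"
  unfolding unique_geodesic_def
proof (intro ballI impI)
  have img: "g ` Rn n = Rn n" and d: "\<And>u v. u \<in> Rn n \<Longrightarrow> v \<in> Rn n \<Longrightarrow> l1dist n (g u) (g v) = l1dist n u v"
    using g by (auto simp: l1isometry_def)
  fix z w assume zw: "z \<in> Rn n" "w \<in> Rn n"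
    and eq: "l1dist n (g x) z + l1dist n z (g y) = l1dist n (g x) (g y)"
      "l1dist n (g x) w + l1dist n w (g y) = l1dist n (g x) (g y)" "l1dist n (g x) z = l1dist n (g x) w"
  obtain z' w' where zw': "z' \<in> Rn n" "w' \<in> Rn n" "z = g z'" "w = g w'" using zw img by (metis imageE)
  have "z' = w'"
    using assms(4) zw'(1,2) eq unfolding zw'(3,4) unique_geodesic_def
    by (simp add: d assms zw')
  then show "z = w" using zw' by simp
qed

lemma unique_geodesic_upd:
  assumes "x \<in> Rn n" "i < n"
  shows "unique_geodesic n x (x(i := t))"
  unfolding unique_geodesic_def
proof (intro ballI impI)
  let ?y = "x(i := t)"
  have other: "z j = x j" if "l1dist n x z + l1dist n z ?y = l1dist n x ?y" "j < n" "j \<noteq> i" for z j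
    using l1dist_additive_coord[OF that(1,2)] that(3) by simp
  fix z w assume z: "z \<in> Rn n" "w \<in> Rn n"
    and eq: "l1dist n x z + l1dist n z ?y = l1dist n x ?y" "l1dist n x w + l1dist n w ?y = l1dist n x ?y"
      "l1dist n x z = l1dist n x w"
  have shape: "u = x(i := u i)" if "u \<in> Rn n" "l1dist n x u + l1dist n u ?y = l1dist n x ?y" for u
    using that other[OF that(2)] assms by (intro Rn_eqI[of _ n] Rn_upd) auto
  have "\<bar>x i - z i\<bar> = \<bar>x i - w i\<bar>"
    using eq(3) shape[OF z(1) eq(1)] shape[OF z(2) eq(2)] l1dist_upd_self[OF assms(2), of x] by metis
  moreover have "\<bar>x i - z i\<bar> + \<bar>z i - t\<bar> = \<bar>x i - t\<bar>" "\<bar>x i - w i\<bar> + \<bar>w i - t\<bar> = \<bar>x i - t\<bar>"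
    using l1dist_additive_coord[OF eq(1) assms(2)] l1dist_additive_coord[OF eq(2) assms(2)] by auto
  ultimately have "z i = w i" by linarith
  then show "z = w" using shape[OF z(1) eq(1)] shape[OF z(2) eq(2)] by metis
qed

text \<open>If \<open>x\<close> and \<open>y\<close> differed in two coordinates, moving a small distance from \<open>x\<close> towards \<open>y\<close>
  in one or in the other coordinate would start two different geodesics.\<close>

lemma unique_geodesicD:
  assumes u: "unique_geodesic n x y" and xy: "x \<in> Rn n" "y \<in> Rn n" and ij: "i < n" "j < n" "x i \<noteq> y i" "x j \<noteq> y j"
  shows "i = j"
proof (rule ccontr)
  assume ne: "i \<noteq> j"
  \<comment> \<open>The smaller gap lets both moves have the same length without overshooting
    \<open>y\<close>.\<close>
  define s where "s = min \<bar>x i - y i\<bar> \<bar>x j - y j\<bar>"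
  have s: "0 < s" "s \<le> \<bar>x i - y i\<bar>" "s \<le> \<bar>x j - y j\<bar>" using ij by (auto simp: s_def)
  define m where "m k = x(k := x k + sgn (y k - x k) * s)" for k
  have m: "m k \<in> Rn n" "l1dist n x (m k) = s" "l1dist n x (m k) + l1dist n (m k) y = l1dist n x y"
    if k: "k < n" "s \<le> \<bar>x k - y k\<bar>" for k
  proof -
    have sg: "\<bar>x k - (x k + sgn (y k - x k) * s)\<bar> = s"
      using k s(1) by (auto simp: sgn_if abs_if)
    show "m k \<in> Rn n" using xy k Rn_upd by (simp add: m_def)
    show "l1dist n x (m k) = s" using l1dist_upd_self[OF k(1), of x] sg by (simp add: m_def)
    have "\<bar>x l - m k l\<bar> + \<bar>m k l - y l\<bar> = \<bar>x l - y l\<bar>" for l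
      using k s(1) by (auto simp: m_def sgn_if abs_if)
    then show "l1dist n x (m k) + l1dist n (m k) y = l1dist n x y"
      unfolding l1dist_def sum.distrib[symmetric] by simp
  qed
  have "m i = m j"
    using u m(1)[OF ij(1) s(2)] m(1)[OF ij(2) s(3)] m(2)[OF ij(1) s(2)] m(2)[OF ij(2) s(3)]
      m(3)[OF ij(1) s(2)] m(3)[OF ij(2) s(3)] unfolding unique_geodesic_def by metis
  then have "m i i = m j i" by simp
  then show False using ne s(1) ij(3) by (auto simp: m_def sgn_if split: if_splits)
qed

section \<open>The form of an isometry and its action on volumes\<close>

lemma l1isometry_translate:
  assumes c: "c \<in> Rn n" shows "l1isometry n (\<lambda>x j. x j + c j)"
proof -
  have "x \<in> (\<lambda>x j. x j + c j) ` Rn n" if "x \<in> Rn n" for x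
    using that c by (intro image_eqI[of _ _ "\<lambda>j. x j - c j"]) (auto simp: Rn_def)
  then show ?thesis using c by (auto simp: l1isometry_def l1dist_def Rn_def)
qed

lemma l1isometry_comp:
  assumes f: "l1isometry n f" and g: "l1isometry n g" shows "l1isometry n (\<lambda>x. f (g x))"
proof -
  have "g x \<in> Rn n" if "x \<in> Rn n" for x using g that by (auto simp: l1isometry_def)
  moreover have "(\<lambda>x. f (g x)) ` Rn n = Rn n" using f g by (simp add: l1isometry_def image_image[symmetric])
  ultimately show ?thesis using f g by (simp add: l1isometry_def)
qed

text \<open>Axis points are sent to axis points because the two ends of an axis-parallel segment are joined
  by only one geodesic; the coordinates of an arbitrary point are then read off from its distances
  to remote axis points.\<close>

lemma l1isometry_fixing_0:
  assumes g: "l1isometry n g" and g0: "g (\<lambda>_. 0) = (\<lambda>_. 0)"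
  obtains k s where "bij_betw k {..<n} {..<n}" "\<And>i. \<bar>s i\<bar> = (1::real)"
    "\<And>x i. x \<in> Rn n \<Longrightarrow> i < n \<Longrightarrow> g x (k i) = s i * x i"
proof -
  have gR: "g x \<in> Rn n" if "x \<in> Rn n" for x using g that by (auto simp: l1isometry_def)
  have d: "l1dist n (g u) (g v) = l1dist n u v" if "u \<in> Rn n" "v \<in> Rn n" for u v
    using g that by (auto simp: l1isometry_def)
  have z: "(\<lambda>_. 0) \<in> Rn n" by (simp add: Rn_def)
  have zax: "(\<lambda>_. 0) = axis_pt i 0" for i by (auto simp: axis_pt_def)
  have ug: "unique_geodesic n (g (axis_pt i a)) (g (axis_pt i b))" if i: "i < n" for i a b
  proof -
    have "unique_geodesic n (axis_pt i a) ((axis_pt i a)(i := b))" by (rule unique_geodesic_upd) (use i in auto)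
    moreover have "(axis_pt i a)(i := b) = axis_pt i b" by (auto simp: axis_pt_def)
    ultimately show ?thesis using unique_geodesic_isometry[OF g] i by auto
  qed
  have "\<exists>k s. k < n \<and> \<bar>s\<bar> = 1 \<and> (\<forall>t. g (axis_pt i t) = axis_pt k (s * t))" if i: "i < n" for i
  proof -
    let ?p = "\<lambda>t. g (axis_pt i t)"
    have pR: "?p t \<in> Rn n" for t using gR i by simp
    have norm: "l1dist n (?p t) (\<lambda>_. 0) = \<bar>t\<bar>" for t
    proof -
      have "l1dist n (?p t) (g (\<lambda>_. 0)) = \<bar>t - 0\<bar>"
        by (subst d) (use i z zax[of i] l1dist_axis_pt_same[OF i] in auto)
      then show ?thesis by (simp add: g0)
    qed
    have shape: "?p t = axis_pt l (?p t l)" if "l < n" "?p t l \<noteq> 0" for t l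
    proof (rule Rn_eqI[OF pR axis_pt_Rn[OF that(1)]])
      fix j assume j: "j < n"
      have "unique_geodesic n (\<lambda>_. 0) (?p t)" using ug[OF i, of 0 t] zax[of i] g0 by simp
      then have "j \<noteq> l \<Longrightarrow> ?p t j = 0"
        using unique_geodesicD[of n "\<lambda>_. 0" "?p t" j l] z pR j that by auto
      then show "?p t j = axis_pt l (?p t l) j" by (auto simp: axis_pt_def)
    qed
    have nz: "\<exists>l<n. ?p t l \<noteq> 0" if "t \<noteq> 0" for t
    proof (rule ccontr)
      assume "\<not> ?thesis"
      then have "l1dist n (?p t) (\<lambda>_. 0) = 0" by (simp add: l1dist_def)
      then show False using norm that by simp
    qed
    obtain l where l: "l < n" "?p 1 l \<noteq> 0" using nz[of 1] by auto
    let ?s = "?p 1 l"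
    have p1: "?p 1 = axis_pt l ?s" using shape[OF l] .
    have s1: "\<bar>?s\<bar> = 1" using norm[of 1] l1dist_axis_pt_same[OF l(1), of ?s 0] p1 zax[of l] by simp
    have "?p t = axis_pt l (?s * t)" for t
    proof (cases "t = 0")
      case True then show ?thesis using g0 zax by (metis mult_zero_right)
    next
      case False
      then obtain m where m: "m < n" "?p t m \<noteq> 0" using nz by blast
      have pt: "?p t = axis_pt m (?p t m)" using shape[OF m] .
      \<comment> \<open>Images on two different axes would differ in two coordinates, although they
        are joined by a unique geodesic.\<close>
      have "m = l"
      proof (rule ccontr)
        assume "m \<noteq> l"
        then have "?p t m \<noteq> ?p 1 m" "?p t l \<noteq> ?p 1 l"
          using m l fun_cong[OF p1, of m] fun_cong[OF pt, of l] by (auto simp: axis_pt_def)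
        then show False using unique_geodesicD[OF ug[OF i] pR pR m(1) l(1)] \<open>m \<noteq> l\<close> by blast
      qed
      have a: "\<bar>?p t l\<bar> = \<bar>t\<bar>"
        using norm[of t] l1dist_axis_pt_same[OF l(1), of "?p t l" 0] pt zax[of l] \<open>m = l\<close> by simp
      have "l1dist n (?p t) (?p 1) = \<bar>t - 1\<bar>" by (subst d) (use i l1dist_axis_pt_same[OF i] in auto)
      then have "\<bar>?p t l - ?s\<bar> = \<bar>t - 1\<bar>"
        using l1dist_axis_pt_same[OF l(1), of "?p t l" ?s] pt p1 \<open>m = l\<close> by simp
      \<comment> \<open>The distances to the origin and to the image of 1 leave a single real
        number.\<close>
      then have "?p t l = ?s * t" using a s1
        by (cases "?s = 1") (auto simp: abs_if split: if_splits)
      then show ?thesis using pt \<open>m = l\<close> by simp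
    qed
    then show ?thesis using l(1) s1 by blast
  qed
  then obtain k s where ks: "\<And>i. i < n \<Longrightarrow> k i < n" "\<And>i. i < n \<Longrightarrow> \<bar>s i\<bar> = (1::real)"
    "\<And>i t. i < n \<Longrightarrow> g (axis_pt i t) = axis_pt (k i) (s i * t)" by metis
  have inj: "inj_on k {..<n}"
  proof (rule inj_onI, rule ccontr)
    fix i j assume ij: "i \<in> {..<n}" "j \<in> {..<n}" "k i = k j" "i \<noteq> j"
    \<comment> \<open>Two axes sent to the same one would give distance 2 for both
      \<open>t = 1\<close> and \<open>t = -1\<close>, yet for one of them the images
      coincide.\<close>
    have "\<bar>s i * 1 - s j * t\<bar> = 1 + \<bar>t\<bar>" for t
    proof -
      have "l1dist n (g (axis_pt i 1)) (g (axis_pt j t)) = 1 + \<bar>t\<bar>"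
        by (subst d) (use ij l1dist_axis_pt_other[of j n i 1 t] in auto)
      then show ?thesis using ij ks l1dist_axis_pt_same[of "k j" n "s i * 1" "s j * t"] by simp
    qed
    from this[of 1] this[of "-1"] show False using ks(2)[of i] ks(2)[of j] ij by auto
  qed
  then have bij: "bij_betw k {..<n} {..<n}"
    using ks(1) by (simp add: bij_betw_def endo_inj_surj image_subset_iff)
  have coord: "g x (k i) = s i * x i" if x: "x \<in> Rn n" and i: "i < n" for x i
  proof -
    \<comment> \<open>Large enough to resolve the absolute values. In the difference of the
      distances to the axis points at \<open>T\<close> and \<open>-T\<close> all other coordinates
      cancel, and what is left is linear in coordinate \<open>i\<close>.\<close>
    define T where "T = \<bar>x i\<bar> + \<bar>g x (k i)\<bar>"
    have e: "l1dist n x (axis_pt i t) = l1dist n (g x) (axis_pt (k i) (s i * t))" for t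
      using d[OF x, of "axis_pt i t"] ks(3)[OF i] i by simp
    have "\<bar>x i - T\<bar> - \<bar>x i - - T\<bar> = \<bar>g x (k i) - s i * T\<bar> - \<bar>g x (k i) - s i * - T\<bar>"
      using e[of T] e[of "-T"] l1dist_axis_pt[OF i, of x] l1dist_axis_pt[OF ks(1)[OF i], of "g x"] by simp
    moreover have "s i = 1 \<or> s i = -1" using ks(2)[OF i] by linarith
    ultimately show ?thesis unfolding T_def by (auto simp: abs_if split: if_splits)
  qed
  show ?thesis
    by (rule that[of k "\<lambda>i. if i < n then s i else 1"]) (use bij ks(2) coord in auto)
qed

lemma l1isometryE:
  assumes g: "l1isometry n g"
  obtains k s c where "bij_betw k {..<n} {..<n}" "\<And>i. \<bar>s i\<bar> = (1::real)"
    "\<And>x i. x \<in> Rn n \<Longrightarrow> i < n \<Longrightarrow> g x (k i) = c (k i) + s i * x i"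
proof -
  have z: "(\<lambda>_. 0) \<in> Rn n" by (simp add: Rn_def)
  have c: "g (\<lambda>_. 0) \<in> Rn n" using g z by (auto simp: l1isometry_def)
  let ?c = "\<lambda>j. - g (\<lambda>_. 0) j"
  have "l1isometry n (\<lambda>x j. x j + ?c j)" by (rule l1isometry_translate) (use c in \<open>simp add: Rn_def\<close>)
  from l1isometry_comp[OF this g] have "l1isometry n (\<lambda>x j. g x j + ?c j)" .
  from l1isometry_fixing_0[OF this] obtain k s where
    "bij_betw k {..<n} {..<n}" "\<And>i. \<bar>s i\<bar> = (1::real)"
    "\<And>x i. x \<in> Rn n \<Longrightarrow> i < n \<Longrightarrow> g x (k i) + ?c (k i) = s i * x i" by auto
  then show ?thesis by (intro that[of k s "g (\<lambda>_. 0)"]) (auto simp: algebra_simps)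
qed

lemma emeasure_lborel_affine_unit:
  fixes s c :: real
  assumes "\<bar>s\<bar> = 1" "A \<in> sets lborel"
  shows "{y. c + s * y \<in> A} \<in> sets lborel" "emeasure lborel {y. c + s * y \<in> A} = emeasure lborel A"
proof -
  have m: "(\<lambda>y. c + s * y) \<in> borel_measurable lborel" by measurable
  have "(\<lambda>y. c + s * y) -` A \<inter> space lborel \<in> sets lborel" by (rule measurable_sets[OF m]) (use assms in simp)
  then show "{y. c + s * y \<in> A} \<in> sets lborel" by (simp add: vimage_def)
  have "s \<noteq> 0" using assms(1) by auto
  from lborel_real_affine[OF this, of c] have "lborel = distr lborel borel (\<lambda>x. c + s * x)"
    using assms(1) by (simp add: density_1)
  then have "emeasure lborel A = emeasure (distr lborel borel (\<lambda>x. c + s * x)) A" by simp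
  also have "\<dots> = emeasure lborel {y. c + s * y \<in> A}"
    using assms(2) m by (subst emeasure_distr) (auto simp: vimage_def)
  finally show "emeasure lborel {y. c + s * y \<in> A} = emeasure lborel A" by simp
qed

text \<open>A product measure is determined by its values on boxes; the preimage of a box is a box
  whose sides are translated, possibly reflected and renamed by \<open>k\<close>.\<close>

lemma distr_PiM_signed_reindex:
  fixes k :: "nat \<Rightarrow> nat" and s c :: "nat \<Rightarrow> real"
  assumes R: "finite R" and k: "inj_on k R" and s: "\<And>i. \<bar>s i\<bar> = 1"
  defines "h \<equiv> \<lambda>y. \<lambda>j\<in>k ` R. c j + s (inv_into R k j) * y (inv_into R k j)"
  shows "h \<in> measurable (PiM R (\<lambda>_. lborel)) (PiM (k ` R) (\<lambda>_. lborel))"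
    and "distr (PiM R (\<lambda>_. lborel)) (PiM (k ` R) (\<lambda>_. lborel)) h = PiM (k ` R) (\<lambda>_. lborel)"
proof -
  interpret product_sigma_finite "\<lambda>_::nat. lborel :: real measure" by (rule product_lborel)
  show h: "h \<in> measurable (PiM R (\<lambda>_. lborel)) (PiM (k ` R) (\<lambda>_. lborel))"
    unfolding h_def
  proof (rule measurable_restrict)
    fix j assume "j \<in> k ` R"
    then have "inv_into R k j \<in> R" by (rule inv_into_into)
    then have "(\<lambda>y. y (inv_into R k j)) \<in> measurable (PiM R (\<lambda>_. lborel :: real measure)) lborel"
      by (rule measurable_component_singleton)
    then show "(\<lambda>y. c j + s (inv_into R k j) * y (inv_into R k j)) \<in> measurable (PiM R (\<lambda>_. lborel)) lborel"
      by simp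
  qed
  show "distr (PiM R (\<lambda>_. lborel)) (PiM (k ` R) (\<lambda>_. lborel)) h = PiM (k ` R) (\<lambda>_. lborel)"
  proof (rule PiM_eqI)
    fix A :: "nat \<Rightarrow> real set" assume A: "\<And>j. j \<in> k ` R \<Longrightarrow> A j \<in> sets lborel"
    let ?B = "\<lambda>i. {y. c (k i) + s i * y \<in> A (k i)}"
    have pre: "h -` PiE (k ` R) A \<inter> space (PiM R (\<lambda>_. lborel)) = PiE R ?B"
    proof (intro equalityI subsetI)
      fix y assume "y \<in> h -` PiE (k ` R) A \<inter> space (PiM R (\<lambda>_. lborel))"
      then show "y \<in> PiE R ?B" using k by (auto simp: h_def space_PiM PiE_iff)
    next
      fix y assume "y \<in> PiE R ?B"
      then show "y \<in> h -` PiE (k ` R) A \<inter> space (PiM R (\<lambda>_. lborel))" using k by (auto simp: h_def space_PiM PiE_iff)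
    qed
    have "emeasure (distr (PiM R (\<lambda>_. lborel)) (PiM (k ` R) (\<lambda>_. lborel)) h) (PiE (k ` R) A) =
        emeasure (PiM R (\<lambda>_. lborel)) (PiE R ?B)"
      using A R by (subst emeasure_distr[OF h]) (auto simp: pre intro!: sets_PiM_I_finite)
    also have "\<dots> = (\<Prod>i\<in>R. emeasure lborel (?B i))"
      by (rule emeasure_PiM[OF R]) (rule emeasure_lborel_affine_unit[OF s A], auto)
    also have "\<dots> = (\<Prod>i\<in>R. emeasure lborel (A (k i)))"
      by (rule prod.cong[OF refl], rule emeasure_lborel_affine_unit[OF s A]) auto
    also have "\<dots> = (\<Prod>j\<in>k ` R. emeasure lborel (A j))" using k by (simp add: prod.reindex)
    finally show "emeasure (distr (PiM R (\<lambda>_. lborel)) (PiM (k ` R) (\<lambda>_. lborel)) h) (PiE (k ` R) A) = \<dots>" .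
  qed (use R in auto)
qed

lemma vol_isometry:
  assumes X: "X \<in> Cn n" and bij: "bij_betw k {..<n} {..<n}" and s: "\<And>i. \<bar>s i\<bar> = (1::real)"
    and g: "\<And>x i. x \<in> Rn n \<Longrightarrow> i < n \<Longrightarrow> g x (k i) = c (k i) + s i * x i" and R: "R \<subseteq> {..<n}"
  shows "vol (k ` R) (g ` X) = vol R X"
proof -
  have fR: "finite R" using R finite_subset by blast
  have inj: "inj_on k R" using bij R by (meson bij_betw_def inj_on_subset)
  let ?h = "\<lambda>y. \<lambda>j\<in>k ` R. c j + s (inv_into R k j) * y (inv_into R k j)"
  let ?K = "(\<lambda>x. restrict x R) ` X"
  note h = distr_PiM_signed_reindex[where s=s and c=c, OF fR inj s]
  have cK: "compact ?K" by (rule compact_restrict_image[OF CnD(2)[OF X]])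
  have "restrict (g x) (k ` R) = ?h (restrict x R)" if "x \<in> X" for x
  proof (rule restrict_ext)
    fix j assume "j \<in> k ` R"
    then obtain i where i: "i \<in> R" "j = k i" by auto
    then show "g x j = c j + s (inv_into R k j) * restrict x R (inv_into R k j)"
      using g[of x i] inj R CnD(1)[OF X] that by (auto simp: inv_into_f_f)
  qed
  then have img: "(\<lambda>x. restrict x (k ` R)) ` (g ` X) = ?h ` ?K"
    unfolding image_image by (rule image_cong[OF refl])
  have "continuous_on ?K ?h"
  proof (rule continuous_on_coordinatewise_then_product)
    fix j
    have "continuous_on ?K (\<lambda>y. y i)" for i by (rule continuous_on_subset[OF continuous_on_product_coordinates]) simp
    then show "continuous_on ?K (\<lambda>y. ?h y j)" by (cases "j \<in> k ` R") (auto intro!: continuous_intros)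
  qed
  then have "compact (?h ` ?K)" using cK by (rule compact_continuous_image)
  then have hK: "?h ` ?K \<in> sets (PiM (k ` R) (\<lambda>_. lborel))" by (rule sets_PiM_compact) auto
  \<comment> \<open>Injectivity on \<open>extensional R\<close> makes the preimage of the image the
    set itself, so the pushforward measure can be evaluated on it.\<close>
  have pre: "?h -` (?h ` ?K) \<inter> space (PiM R (\<lambda>_. lborel)) = ?K"
  proof -
    have injh: "y = y'" if "?h y = ?h y'" "y \<in> extensional R" "y' \<in> extensional R" for y y'
    proof
      fix i show "y i = y' i"
      proof (cases "i \<in> R")
        case True
        then have "?h y (k i) = ?h y' (k i)" using that(1) by metis
        then have "s i * y i = s i * y' i" using True inj by simp
        moreover have "s i \<noteq> 0" using s[of i] by auto
        ultimately show ?thesis by simp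
      next
        case False then show ?thesis using that by (simp add: extensional_def)
      qed
    qed
    have ext: "?K \<subseteq> extensional R" by auto
    have sp: "space (PiM R (\<lambda>_. lborel :: real measure)) = extensional R" by (simp add: space_PiM PiE_def)
    show ?thesis unfolding sp using injh ext by blast
  qed
  have "measure (PiM (k ` R) (\<lambda>_. lborel)) (?h ` ?K) = measure (distr (PiM R (\<lambda>_. lborel)) (PiM (k ` R) (\<lambda>_. lborel)) ?h) (?h ` ?K)"
    by (simp only: h(2))
  also have "\<dots> = measure (PiM R (\<lambda>_. lborel)) ?K"
    by (subst measure_distr[OF h(1) hK]) (simp only: pre)
  finally show ?thesis by (simp only: vol_def img)
qed

text \<open>A single projected volume is not invariant; an isometry permutes them through its action
  on index sets of equal size, and the sum is unaffected.\<close>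

lemma invariant_intrinsic_volume: "invariant n (intrinsic_volume n i)"
  unfolding invariant_def
proof (intro allI impI ballI)
  fix g X assume g: "l1isometry n g" and X: "X \<in> Cn n"
  obtain k s c where k: "bij_betw k {..<n} {..<n}" and s: "\<And>i. \<bar>s i\<bar> = (1::real)"
    and gk: "\<And>x i. x \<in> Rn n \<Longrightarrow> i < n \<Longrightarrow> g x (k i) = c (k i) + s i * x i"
    using l1isometryE[OF g] by metis
  let ?Q = "{S. S \<subseteq> {..<n} \<and> card S = i}"
  have inj: "inj_on k {..<n}" and sur: "k ` {..<n} = {..<n}" using k by (auto simp: bij_betw_def)
  have "bij_betw (image k) ?Q ?Q"
  proof (rule bij_betwI')
    fix R S assume "R \<in> ?Q" "S \<in> ?Q"
    then show "(k ` R = k ` S) = (R = S)" using inj by (simp add: inj_on_image_eq_iff)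
  next
    fix R assume "R \<in> ?Q"
    then show "k ` R \<in> ?Q" using inj sur card_image[OF inj_on_subset[OF inj]] by auto
  next
    fix S assume S: "S \<in> ?Q"
    then obtain R where R: "R \<subseteq> {..<n}" "S = k ` R" using sur by (metis (no_types, lifting) mem_Collect_eq subset_image_iff)
    then have "card R = i" using S card_image[OF inj_on_subset[OF inj R(1)]] by simp
    then show "\<exists>R\<in>?Q. S = k ` R" using R by blast
  qed
  then have "intrinsic_volume n i (g ` X) = (\<Sum>R\<in>?Q. vol (k ` R) (g ` X))"
    unfolding intrinsic_volume_vol by (rule sum.reindex_bij_betw[symmetric])
  also have "\<dots> = intrinsic_volume n i X"
    unfolding intrinsic_volume_vol by (rule sum.cong[OF refl], rule vol_isometry[OF X k s gk]) auto
  finally show "intrinsic_volume n i (g ` X) = intrinsic_volume n i X" .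
qed

section \<open>Linear combinations, and membership in \<open>Val n\<close>\<close>

lemma valuation_lincomb:
  assumes "finite A" "\<And>a. a \<in> A \<Longrightarrow> valuation n (f a)"
  shows "valuation n (\<lambda>X. \<Sum>a\<in>A. c a * f a X)"
  unfolding valuation_def
proof (intro conjI allI impI)
  show "(\<Sum>a\<in>A. c a * f a {}) = 0" using assms(2) by (simp add: valuation_def)
  fix X Y assume "X \<in> Cn n" "Y \<in> Cn n" "X \<union> Y \<in> Cn n" "X \<inter> Y \<in> Cn n"
  then have "f a (X \<union> Y) = f a X + f a Y - f a (X \<inter> Y)" if "a \<in> A" for a
    using assms(2)[OF that] by (simp add: valuation_def)
  then have "(\<Sum>a\<in>A. c a * f a (X \<union> Y)) = (\<Sum>a\<in>A. c a * (f a X + f a Y - f a (X \<inter> Y)))"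
    by (intro sum.cong) auto
  then show "(\<Sum>a\<in>A. c a * f a (X \<union> Y)) = (\<Sum>a\<in>A. c a * f a X) + (\<Sum>a\<in>A. c a * f a Y) - (\<Sum>a\<in>A. c a * f a (X \<inter> Y))"
    by (simp add: algebra_simps sum.distrib sum_subtractf)
qed

lemma hcontinuous_lincomb2:
  assumes "hcontinuous n f" "hcontinuous n g"
  shows "hcontinuous n (\<lambda>X. f X + c * g X)"
  unfolding hcontinuous_def
proof (intro ballI allI impI)
  fix X and \<epsilon> :: real assume X: "X \<in> Cn n - {{}}" and e: "0 < \<epsilon>"
  \<comment> \<open>The added 1 covers \<open>c = 0\<close>.\<close>
  let ?e = "\<epsilon> / (2 * (\<bar>c\<bar> + 1))"
  have e': "0 < ?e" "0 < \<epsilon> / 2" using e by auto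
  obtain d1 where d1: "d1 > 0" "\<And>Y. Y \<in> Cn n - {{}} \<Longrightarrow> hdist n X Y < d1 \<Longrightarrow> \<bar>f Y - f X\<bar> < \<epsilon> / 2"
    using assms(1)[unfolded hcontinuous_def, rule_format, OF X e'(2)] by blast
  obtain d2 where d2: "d2 > 0" "\<And>Y. Y \<in> Cn n - {{}} \<Longrightarrow> hdist n X Y < d2 \<Longrightarrow> \<bar>g Y - g X\<bar> < ?e"
    using assms(2)[unfolded hcontinuous_def, rule_format, OF X e'(1)] by blast
  have "\<bar>(f Y + c * g Y) - (f X + c * g X)\<bar> < \<epsilon>" if "Y \<in> Cn n - {{}}" "hdist n X Y < min d1 d2" for Y
  proof -
    have 1: "\<bar>f Y - f X\<bar> < \<epsilon> / 2" and 2: "\<bar>g Y - g X\<bar> < ?e" using d1(2) d2(2) that by auto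
    have "\<bar>c * (g Y - g X)\<bar> \<le> \<bar>c\<bar> * ?e"
      unfolding abs_mult using 2 by (intro mult_left_mono) auto
    also have "\<dots> \<le> \<epsilon> / 2" using e by (simp add: field_simps)
    finally have "\<bar>c * (g Y - g X)\<bar> \<le> \<epsilon> / 2" .
    moreover have "(f Y + c * g Y) - (f X + c * g X) = (f Y - f X) + c * (g Y - g X)" by (simp add: algebra_simps)
    ultimately show ?thesis using 1 by linarith
  qed
  then show "\<exists>\<delta>>0. \<forall>Y\<in>Cn n - {{}}. hdist n X Y < \<delta> \<longrightarrow> \<bar>(f Y + c * g Y) - (f X + c * g X)\<bar> < \<epsilon>"
    using d1(1) d2(1) by (intro exI[of _ "min d1 d2"]) auto
qed

lemma hcontinuous_lincomb:
  assumes "finite A" "\<And>a. a \<in> A \<Longrightarrow> hcontinuous n (f a)"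
  shows "hcontinuous n (\<lambda>X. \<Sum>a\<in>A. c a * f a X)"
  using assms
proof (induction A rule: finite_induct)
  case empty then show ?case by (auto simp: hcontinuous_def intro: exI[of _ "1::real"])
next
  case (insert a A)
  then have "hcontinuous n (\<lambda>X. (\<Sum>a\<in>A. c a * f a X) + c a * f a X)"
    by (intro hcontinuous_lincomb2) auto
  then show ?case using insert by (simp add: add.commute)
qed

lemma intrinsic_volume_Val: "intrinsic_volume n i \<in> Val n"
proof -
  let ?Q = "{S. S \<subseteq> {..<n} \<and> card S = i}"
  have eq: "intrinsic_volume n i = (\<lambda>X. \<Sum>S\<in>?Q. 1 * vol S X)"
    by (auto simp: intrinsic_volume_vol)
  have Q: "finite ?Q" by (rule finite_subset[of _ "Pow {..<n}"]) auto
  have "valuation n (intrinsic_volume n i)" unfolding eq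
    by (rule valuation_lincomb[OF Q]) (auto intro: valuation_vol)
  moreover have "hcontinuous n (intrinsic_volume n i)" unfolding eq
    by (rule hcontinuous_lincomb[OF Q]) (auto intro: hcontinuous_vol)
  ultimately show ?thesis using invariant_intrinsic_volume by (simp add: Val_def)
qed

section \<open>Values on boxes\<close>

text \<open>Subtracting the linear function leaves an additive function that vanishes at integers,
  hence has period 1 and is bounded on all nonnegative reals. Its values at the multiples of
  \<open>t\<close> would be unbounded unless it vanishes at \<open>t\<close>.\<close>

lemma additive_bounded_imp_linear:
  fixes h :: "real \<Rightarrow> real"
  assumes add: "\<And>s t. 0 \<le> s \<Longrightarrow> 0 \<le> t \<Longrightarrow> h (s + t) = h s + h t"
    and bdd: "\<And>t. 0 \<le> t \<Longrightarrow> t \<le> 1 \<Longrightarrow> \<bar>h t\<bar> \<le> B" and t: "0 \<le> t"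
  shows "h t = t * h 1"
proof -
  define k where "k t = h t - t * h 1" for t
  have kadd: "k (s + t) = k s + k t" if "0 \<le> s" "0 \<le> t" for s t
    using add[OF that] by (simp add: k_def algebra_simps)
  have k0: "k 0 = 0" using kadd[of 0 0] by simp
  have k1: "k 1 = 0" by (simp add: k_def)
  have kmul: "k (real m * s) = real m * k s" if "0 \<le> s" for m s
  proof (induction m)
    case 0 then show ?case using k0 by simp
  next
    case (Suc m)
    have "k (real m * s + s) = k (real m * s) + k s" by (rule kadd) (use that in auto)
    then show ?case using Suc by (simp add: algebra_simps)
  qed
  have kb: "\<bar>k s\<bar> \<le> B + \<bar>h 1\<bar>" if "0 \<le> s" "s \<le> 1" for s
  proof -
    have "\<bar>s * h 1\<bar> \<le> 1 * \<bar>h 1\<bar>" unfolding abs_mult using that by (intro mult_right_mono) auto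
    then show ?thesis using bdd[OF that] by (simp add: k_def)
  qed
  have bound: "real m * \<bar>k t\<bar> \<le> B + \<bar>h 1\<bar>" for m
  proof -
    define N where "N = nat \<lfloor>real m * t\<rfloor>"
    define r where "r = real m * t - real N"
    have mt: "0 \<le> real m * t" using t by simp
    have "real N = of_int \<lfloor>real m * t\<rfloor>" using mt by (simp add: N_def)
    then have r: "0 \<le> r" "r \<le> 1" unfolding r_def by linarith+
    have "k (real N * 1 + r) = k (real N * 1) + k r" by (rule kadd) (use r in auto)
    moreover have "k (real N * 1) = 0" using kmul[of 1 N] k1 by simp
    ultimately have "k (real m * t) = k r" by (simp add: r_def)
    then have "\<bar>real m * k t\<bar> = \<bar>k r\<bar>" using kmul[OF t] by simp
    then show ?thesis using kb[OF r] by (simp add: abs_mult)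
  qed
  have "k t = 0"
  proof (rule ccontr)
    assume "k t \<noteq> 0"
    then obtain m where "B + \<bar>h 1\<bar> < real m * \<bar>k t\<bar>" using reals_Archimedean3[of "\<bar>k t\<bar>"] by auto
    then show False using bound[of m] by linarith
  qed
  then show ?thesis by (simp add: k_def)
qed

section \<open>Invariant valuations on boxes\<close>

lemma valuationD:
  "\<lbrakk>valuation n \<phi>; X \<in> Cn n; Y \<in> Cn n; X \<union> Y \<in> Cn n; X \<inter> Y \<in> Cn n\<rbrakk> \<Longrightarrow>
    \<phi> (X \<union> Y) = \<phi> X + \<phi> Y - \<phi> (X \<inter> Y)"
  by (simp add: valuation_def)

lemma CI_lessThan: "CI n {..<n} = Cn n"
  by (auto simp: CI_def RI_lessThan dest: CnD)

lemma Cn_lbox: "a \<in> Rn n \<Longrightarrow> b \<in> Rn n \<Longrightarrow> lbox a b \<in> Cn n"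
  using star_CI[of "{..<n}" n "lbox a b" b] lbox_subset_RI[of a "{..<n}" b] compact_lbox star_to_lbox
  by (simp add: CI_lessThan RI_lessThan)

lemma lbox_translate: "(\<lambda>x j. x j + c j) ` lbox a b = lbox (\<lambda>j. a j + c j) (\<lambda>j. b j + c j)"
proof -
  have iff: "y - c \<in> closed_segment a b \<longleftrightarrow> y \<in> closed_segment (a + c) (b + c)" for y a b c :: real
    by (auto simp: closed_segment_eq_real_ivl)
  show ?thesis
  proof (intro equalityI subsetI)
    fix y assume "y \<in> (\<lambda>x j. x j + c j) ` lbox a b"
    then show "y \<in> lbox (\<lambda>j. a j + c j) (\<lambda>j. b j + c j)" by (auto simp: lbox_def iff[symmetric])
  next
    fix y assume "y \<in> lbox (\<lambda>j. a j + c j) (\<lambda>j. b j + c j)"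
    then have "(\<lambda>j. y j - c j) \<in> lbox a b" by (simp add: lbox_def iff)
    then show "y \<in> (\<lambda>x j. x j + c j) ` lbox a b" by (intro image_eqI[of _ _ "\<lambda>j. y j - c j"]) auto
  qed
qed

lemma Val_translate_lbox:
  assumes "\<phi> \<in> Val n" "a \<in> Rn n" "b \<in> Rn n" "c \<in> Rn n"
  shows "\<phi> (lbox (\<lambda>j. a j + c j) (\<lambda>j. b j + c j)) = \<phi> (lbox a b)"
  using assms l1isometry_translate[OF assms(4)] Cn_lbox[OF assms(2,3)]
  by (auto simp: Val_def invariant_def lbox_translate[symmetric])

lemma lbox_0: "(\<And>j. 0 \<le> a j) \<Longrightarrow> lbox (\<lambda>_. 0) a = {y. \<forall>j. 0 \<le> y j \<and> y j \<le> a j}"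
  by (simp add: lbox_def closed_segment_eq_real_ivl)

text \<open>Cutting a box across direction \<open>i\<close> gives two boxes, one of them translated,
  whose common face is a translate of the box of length 0. Subtracting the value of that face makes
  the dependence on the length additive, and continuity bounds it on \<open>{0..1}\<close>.\<close>

lemma Val_box_affine:
  assumes \<phi>: "\<phi> \<in> Val n" and a: "a \<in> Rn n" "\<And>j. 0 \<le> a j" and i: "i < n" and t: "0 \<le> t"
  shows "\<phi> (lbox (\<lambda>_. 0) (a(i := t))) =
    \<phi> (lbox (\<lambda>_. 0) (a(i := 0))) + t * (\<phi> (lbox (\<lambda>_. 0) (a(i := 1))) - \<phi> (lbox (\<lambda>_. 0) (a(i := 0))))"
proof -
  let ?z = "(\<lambda>_. 0) :: nat \<Rightarrow> real"
  let ?B = "\<lambda>t. lbox ?z (a(i := t))"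
  have zR: "?z \<in> Rn n" and aR: "a(i := t) \<in> Rn n" and ziR: "?z(i := t) \<in> Rn n" for t
    using a(1) i by (auto simp: Rn_def)
  have BC: "?B t \<in> Cn n" for t by (rule Cn_lbox[OF zR aR])
  have Beq: "?B t = {y. (\<forall>j. j \<noteq> i \<longrightarrow> 0 \<le> y j \<and> y j \<le> a j) \<and> 0 \<le> y i \<and> y i \<le> t}" if "0 \<le> t" for t
  proof -
    have "?B t = {y. \<forall>j. 0 \<le> y j \<and> y j \<le> (a(i := t)) j}" by (rule lbox_0) (use a(2) that in auto)
    then show ?thesis by (auto split: if_splits)
  qed
  have Beq2: "lbox (?z(i := s)) (a(i := t)) = {y. (\<forall>j. j \<noteq> i \<longrightarrow> 0 \<le> y j \<and> y j \<le> a j) \<and> s \<le> y i \<and> y i \<le> t}"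
    if "s \<le> t" for s t
  proof -
    have "y \<in> lbox (?z(i := s)) (a(i := t)) \<longleftrightarrow> (\<forall>j. if j = i then s \<le> y i \<and> y i \<le> t else 0 \<le> y j \<and> y j \<le> a j)" for y
      unfolding lbox_def mem_Collect_eq
      by (rule iff_allI) (use a(2) that in \<open>auto simp: closed_segment_eq_real_ivl\<close>)
    then show ?thesis by (auto split: if_splits)
  qed
  have val: "valuation n \<phi>" using \<phi> by (simp add: Val_def)
  have tr: "\<phi> (lbox (?z(i := s)) (a(i := s + t))) = \<phi> (?B t)" for s t
  proof -
    have e1: "(\<lambda>j. ?z j + (?z(i := s)) j) = ?z(i := s)" by auto
    have e2: "(\<lambda>j. (a(i := t)) j + (?z(i := s)) j) = a(i := s + t)" by auto
    have "\<phi> (lbox (\<lambda>j. ?z j + (?z(i := s)) j) (\<lambda>j. (a(i := t)) j + (?z(i := s)) j)) = \<phi> (?B t)"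
      by (rule Val_translate_lbox[OF \<phi> zR aR ziR])
    then show ?thesis unfolding e1 e2 .
  qed
  define h where "h t = \<phi> (?B t) - \<phi> (?B 0)" for t
  have "h (s + t) = h s + h t" if st: "0 \<le> s" "0 \<le> t" for s t
  proof -
    let ?C = "lbox (?z(i := s)) (a(i := s + t))" and ?D = "lbox (?z(i := s)) (a(i := s))"
    have un: "?B s \<union> ?C = ?B (s + t)" and int: "?B s \<inter> ?C = ?D"
      using st by (auto simp: Beq Beq2)
    have "\<phi> (?B s \<union> ?C) = \<phi> (?B s) + \<phi> ?C - \<phi> (?B s \<inter> ?C)"
      by (rule valuationD[OF val BC Cn_lbox[OF ziR aR]]) (simp_all only: un int BC Cn_lbox[OF ziR aR])
    then have "\<phi> (?B (s + t)) = \<phi> (?B s) + \<phi> (?B t) - \<phi> (?B 0)"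
      using tr[of s t] tr[of s 0] by (simp add: un int)
    then show ?thesis by (simp add: h_def)
  qed
  moreover obtain M where "\<And>t. 0 \<le> t \<Longrightarrow> t \<le> 1 \<Longrightarrow> \<bar>h t\<bar> \<le> M"
  proof -
    have near: "near n r (?B t) (?B u)" if tu: "0 \<le> t" "0 \<le> u" "\<bar>t - u\<bar> \<le> r" for t u r
    proof -
      \<comment> \<open>Truncating coordinate \<open>i\<close> at the new length moves a point by no
        more than the change of length.\<close>
      have half: "\<exists>y\<in>?B u. l1dist n x y \<le> r" if "x \<in> ?B t" "0 \<le> t" "0 \<le> u" "\<bar>t - u\<bar> \<le> r" for x t u
      proof (rule bexI[of _ "x(i := min (x i) u)"])
        have x: "x i \<le> t" using that by (simp add: Beq)
        then show "l1dist n x (x(i := min (x i) u)) \<le> r"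
          using that(4) by (subst l1dist_upd_self[OF i]) (auto simp: min_def abs_if split: if_splits)
        show "x(i := min (x i) u) \<in> ?B u" using that by (auto simp: Beq)
      qed
      show ?thesis unfolding near_def
      proof (intro conjI ballI)
        show "\<exists>y\<in>?B u. l1dist n x y \<le> r" if "x \<in> ?B t" for x using half that tu by blast
        show "\<exists>x\<in>?B t. l1dist n x y \<le> r" if "y \<in> ?B u" for y
          using half[of y u t] that tu by (auto simp: abs_minus_commute l1dist_commute)
      qed
    qed
    have ne: "?B t \<noteq> {}" for t using lbox_ends(1) by blast
    have "continuous_on {0..1} h"
      unfolding continuous_on_iff dist_real_def
    proof (intro ballI allI impI)
      fix t e :: real assume t: "t \<in> {0..1}" and e: "0 < e"
      have "hcontinuous n \<phi>" using \<phi> by (simp add: Val_def)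
      moreover have "?B t \<in> Cn n - {{}}" using BC ne by blast
      ultimately obtain d where d: "d > 0" "\<And>Y. Y \<in> Cn n - {{}} \<Longrightarrow> near n d (?B t) Y \<Longrightarrow> \<bar>\<phi> Y - \<phi> (?B t)\<bar> < e"
        using e unfolding hcontinuous_near by meson
      have "\<bar>h u - h t\<bar> < e" if u: "u \<in> {0..1}" "\<bar>u - t\<bar> < d" for u
        using d(2)[of "?B u"] BC[of u] ne[of u] near[of t u d] t u by (auto simp: h_def abs_minus_commute)
      then show "\<exists>d>0. \<forall>u\<in>{0..1}. \<bar>u - t\<bar> < d \<longrightarrow> \<bar>h u - h t\<bar> < e" using d(1) by blast
    qed
    then have "compact (h ` {0..1})" by (rule compact_continuous_image) simp
    then have "bounded (h ` {0..1})" by (rule compact_imp_bounded)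
    then obtain M where "\<forall>t\<in>{0..1}. \<bar>h t\<bar> \<le> M" by (auto simp: bounded_iff)
    then show ?thesis using that[of M] by auto
  qed
  ultimately have "h t = t * h 1" using t by (intro additive_bounded_imp_linear) auto
  then show ?thesis by (simp add: h_def)
qed

definition unit_box :: "nat set \<Rightarrow> (nat \<Rightarrow> real) set" where
  "unit_box T = lbox (\<lambda>_. 0) (\<lambda>j. if j \<in> T then 1 else 0)"

lemma unit_box_eq: "unit_box T = {y. \<forall>j. 0 \<le> y j \<and> y j \<le> (if j \<in> T then 1 else 0)}"
  unfolding unit_box_def by (rule lbox_0) simp

lemma unit_box_Cn: "T \<subseteq> {..<n} \<Longrightarrow> unit_box T \<in> Cn n"
  unfolding unit_box_def by (rule Cn_lbox) (auto simp: Rn_def)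

text \<open>A bijection of \<open>T\<close> with an initial segment, combined with one of the
  complements, is a permutation of all coordinates and hence gives an isometry.\<close>

lemma Val_unit_box_card:
  assumes \<phi>: "\<phi> \<in> Val n" and T: "T \<subseteq> {..<n}"
  shows "\<phi> (unit_box T) = \<phi> (unit_box {..<card T})"
proof -
  let ?m = "card T"
  have m: "?m \<le> n" using card_mono[OF _ T] by simp
  have fT: "finite T" using T finite_subset by blast
  obtain f where f: "bij_betw f T {..<?m}" using finite_same_card_bij[of T "{..<?m}"] fT by auto
  have "card ({..<n} - T) = card {?m..<n}" using T fT by (simp add: card_Diff_subset)
  then obtain e where e: "bij_betw e ({..<n} - T) {?m..<n}"
    using finite_same_card_bij[of "{..<n} - T" "{?m..<n}"] by auto
  define p where "p j = (if j \<in> T then f j else e j)" for j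
  have pT: "bij_betw p T {..<?m}" using f by (rule bij_betw_cong[THEN iffD1, rotated]) (simp add: p_def)
  have pC: "bij_betw p ({..<n} - T) {?m..<n}" using e by (rule bij_betw_cong[THEN iffD1, rotated]) (simp add: p_def)
  have "bij_betw p (T \<union> ({..<n} - T)) ({..<?m} \<union> {?m..<n})"
    by (rule bij_betw_combine[OF pT pC]) auto
  moreover have "T \<union> ({..<n} - T) = {..<n}" "{..<?m} \<union> {?m..<n} = {..<n}" using T m by auto
  ultimately have p: "bij_betw p {..<n} {..<n}" by simp
  have pn: "p j < n" if "j < n" for j using p that by (auto simp: bij_betw_def)
  have pTi: "p j < ?m \<longleftrightarrow> j \<in> T" if "j < n" for j
    using bij_betwE[OF pT] bij_betwE[OF pC] that by (cases "j \<in> T") force+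
  let ?q = "inv_into {..<n} p"
  have qp: "?q (p j) = j" if "j < n" for j using p that by (simp add: bij_betw_inv_into_left)
  have pq: "p (?q j) = j" "?q j < n" if "j < n" for j
    using p that bij_betw_inv_into_right[OF p, of j] bij_betw_inv_into[OF p] by (auto simp: bij_betw_def)
  \<comment> \<open>The permutation acts by pullback, so it is \<open>p\<close>, not its inverse,
    that must carry \<open>T\<close> to the initial segment.\<close>
  define g where "g x j = (if j < n then x (p j) else 0)" for x :: "nat \<Rightarrow> real" and j
  define g' where "g' x j = (if j < n then x (?q j) else 0)" for x :: "nat \<Rightarrow> real" and j
  have gg: "g (g' x) = x" if "x \<in> Rn n" for x
    using that by (auto simp: g_def g'_def fun_eq_iff qp pn Rn_def)
  have gR: "g x \<in> Rn n" "g' x \<in> Rn n" for x by (auto simp: g_def g'_def Rn_def)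
  have "g ` Rn n = Rn n" using gg gR by (metis image_iff subsetI subset_antisym image_subsetI)
  moreover have "l1dist n (g x) (g y) = l1dist n x y" for x y
    unfolding l1dist_def g_def
    using sum.reindex_bij_betw[OF p, of "\<lambda>j. \<bar>x j - y j\<bar>"] by simp
  ultimately have "l1isometry n g" by (simp add: l1isometry_def)
  moreover have "g ` unit_box {..<?m} = unit_box T"
  proof (intro equalityI subsetI)
    fix y assume "y \<in> g ` unit_box {..<?m}"
    then obtain x where x: "x \<in> unit_box {..<?m}" "y = g x" by blast
    have "0 \<le> g x j \<and> g x j \<le> (if j \<in> T then 1 else 0)" for j
    proof (cases "j < n")
      case True
      have "0 \<le> x (p j) \<and> x (p j) \<le> (if p j < ?m then 1 else 0)" using x(1) by (simp add: unit_box_eq)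
      then show ?thesis using True pTi by (simp add: g_def)
    next
      case False then show ?thesis using T by (auto simp: g_def)
    qed
    then show "y \<in> unit_box T" using x by (simp add: unit_box_eq)
  next
    fix y assume y: "y \<in> unit_box T"
    have "0 \<le> g' y j \<and> g' y j \<le> (if j < ?m then 1 else 0)" for j
    proof (cases "j < n")
      case True
      have "0 \<le> y (?q j) \<and> y (?q j) \<le> (if ?q j \<in> T then 1 else 0)" using y by (simp add: unit_box_eq)
      then show ?thesis using True pTi[of "?q j"] pq[OF True] by (simp add: g'_def)
    next
      case False then show ?thesis using m by (simp add: g'_def)
    qed
    then have "g' y \<in> unit_box {..<?m}" by (simp add: unit_box_eq)
    moreover have "y \<in> Rn n" using y CnD(1)[OF unit_box_Cn[OF T]] by blast
    ultimately show "y \<in> g ` unit_box {..<?m}" using gg by (metis image_eqI)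
  qed
  moreover have "unit_box {..<?m} \<in> Cn n" by (rule unit_box_Cn) (use m in auto)
  ultimately show ?thesis using \<phi> unfolding Val_def invariant_def by (metis (mono_tags, lifting) mem_Collect_eq)
qed

text \<open>An affine function that vanishes at 0 and 1 is zero, so side lengths outside
  \<open>{0, 1}\<close> can be removed one by one; \<open>J\<close> lists where they may
  occur.\<close>

lemma Val_lbox_zero:
  assumes \<phi>: "\<phi> \<in> Val n" and unit: "\<And>k. k \<le> n \<Longrightarrow> \<phi> (unit_box {..<k}) = 0"
    and pq: "p \<in> Rn n" "q \<in> Rn n"
  shows "\<phi> (lbox p q) = 0"
proof -
  have zero: "\<phi> (lbox (\<lambda>_. 0) a) = 0"
    if "finite J" "a \<in> Rn n" "\<And>j. 0 \<le> a j" "\<And>j. j < n \<Longrightarrow> j \<notin> J \<Longrightarrow> a j \<in> {0, 1}" for J a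
    using that
  proof (induction J arbitrary: a rule: finite_induct)
    case empty
    let ?T = "{j. j < n \<and> a j = 1}"
    have "a = (\<lambda>j. if j \<in> ?T then 1 else 0)"
    proof
      fix j show "a j = (if j \<in> ?T then 1 else 0)"
        using empty.prems(3)[of j] Rn_coord[OF empty.prems(1), of j] by (cases "j < n") auto
    qed
    then have "lbox (\<lambda>_. 0) a = unit_box ?T" unfolding unit_box_def by (rule arg_cong)
    moreover have "?T \<subseteq> {..<n}" by auto
    moreover have "card ?T \<le> n" using card_mono[of "{..<n}" ?T] by auto
    ultimately show ?case using Val_unit_box_card[OF \<phi>, of ?T] unit[of "card ?T"] by (simp only:)
  next
    case (insert i J)
    show ?case
    proof (cases "i < n")
      case True
      have 0: "\<phi> (lbox (\<lambda>_. 0) (a(i := v))) = 0" if "v \<in> {0, 1}" for v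
        by (rule insert.IH) (use insert.prems that True in \<open>auto simp: Rn_def\<close>)
      show ?thesis
        using Val_box_affine[OF \<phi> insert.prems(1,2) True insert.prems(2)[of i]] 0[of 0] 0[of 1] by simp
    next
      case False
      then show ?thesis using insert.prems by (intro insert.IH) auto
    qed
  qed
  define c where "c j = min (p j) (q j)" for j
  define a where "a j = \<bar>p j - q j\<bar>" for j
  have cR: "c \<in> Rn n" and aR: "a \<in> Rn n" using pq by (auto simp: c_def a_def Rn_def)
  have "y \<in> closed_segment (p j) (q j) \<longleftrightarrow> y \<in> closed_segment (0 + c j) (a j + c j)" for y j
    by (auto simp: c_def a_def closed_segment_eq_real_ivl abs_if min_def)
  then have "lbox p q = lbox (\<lambda>j. 0 + c j) (\<lambda>j. a j + c j)" by (simp add: lbox_def)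
  also have "\<phi> \<dots> = \<phi> (lbox (\<lambda>_. 0) a)"
    using Val_translate_lbox[OF \<phi> _ aR cR, of "\<lambda>_. 0"] by (simp add: Rn_def)
  also have "\<dots> = 0" by (rule zero[of "{..<n}"]) (use aR in \<open>auto simp: a_def\<close>)
  finally show ?thesis .
qed

lemma Val_zero:
  assumes \<phi>: "\<phi> \<in> Val n" and unit: "\<And>k. k \<le> n \<Longrightarrow> \<phi> (unit_box {..<k}) = 0" and X: "X \<in> Cn n"
  shows "\<phi> X = 0"
proof (rule box_null_zero[of "{..<n}" n])
  have "valuation n \<phi>" "hcontinuous n \<phi>" using \<phi> by (auto simp: Val_def)
  then show "box_null n {..<n} \<phi>"
    unfolding box_null_def CI_lessThan RI_lessThan hcontinuous_near valuation_def
    using Val_lbox_zero[OF \<phi> unit] by simp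
qed (use X CI_lessThan in auto)

section \<open>Unit cubes and the binomial system\<close>

lemma vol_unit_box:
  assumes "finite S"
  shows "vol S (unit_box T) = (if S \<subseteq> T then 1 else 0)"
proof -
  interpret product_sigma_finite "\<lambda>_::nat. lborel :: real measure" by (rule product_lborel)
  have "(\<lambda>x. restrict x S) ` unit_box T = PiE S (\<lambda>j. {0..if j \<in> T then 1 else 0})"
  proof (intro equalityI subsetI)
    fix y assume y: "y \<in> PiE S (\<lambda>j. {0..if j \<in> T then 1 else 0::real})"
    let ?x = "\<lambda>j. if j \<in> S then y j else 0"
    have "?x \<in> unit_box T" using y by (auto simp: unit_box_eq PiE_iff)
    moreover have "y = restrict ?x S" using y by (auto simp: PiE_iff extensional_def fun_eq_iff)
    ultimately show "y \<in> (\<lambda>x. restrict x S) ` unit_box T" by blast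
  qed (auto simp: unit_box_eq)
  then have "vol S (unit_box T) = measure (PiM S (\<lambda>_. lborel)) (PiE S (\<lambda>j. {0..if j \<in> T then 1 else 0::real}))"
    by (simp add: vol_def)
  also have "\<dots> = enn2real (\<Prod>j\<in>S. ennreal (if j \<in> T then 1 else 0))"
    unfolding measure_def using assms by (subst emeasure_PiM) (auto intro!: arg_cong[where f=enn2real] prod.cong)
  also have "\<dots> = (\<Prod>j\<in>S. if j \<in> T then 1 else 0)"
    by (subst prod_ennreal) (auto intro!: enn2real_ennreal prod_nonneg)
  \<comment> \<open>A coordinate of \<open>S\<close> outside \<open>T\<close> contributes a
    degenerate side; for empty \<open>S\<close> the empty product gives 1.\<close>
  also have "\<dots> = (if S \<subseteq> T then 1 else 0)"
    using assms by (auto simp: prod_zero_iff intro!: prod.neutral)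
  finally show ?thesis .
qed

lemma intrinsic_volume_unit_box:
  assumes "k \<le> n" shows "intrinsic_volume n i (unit_box {..<k}) = real (k choose i)"
proof -
  let ?Q = "{S. S \<subseteq> {..<n} \<and> card S = i}"
  have Q: "finite ?Q" by (rule finite_subset[of _ "Pow {..<n}"]) auto
  have "intrinsic_volume n i (unit_box {..<k}) = (\<Sum>S\<in>?Q. if S \<subseteq> {..<k} then 1 else 0)"
    unfolding intrinsic_volume_vol by (rule sum.cong[OF refl], rule vol_unit_box) (auto intro: finite_subset)
  also have "\<dots> = real (card {S \<in> ?Q. S \<subseteq> {..<k}})"
    using Q by (simp add: sum.If_cases Int_def)
  also have "{S \<in> ?Q. S \<subseteq> {..<k}} = {S. S \<subseteq> {..<k} \<and> card S = i}" using assms by auto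
  also have "real (card \<dots>) = real (k choose i)" using n_subsets[of "{..<k}" i] by simp
  finally show ?thesis .
qed

text \<open>Forward substitution: changing \<open>c m\<close> by \<open>d\<close> leaves the
  equations before \<open>m\<close> alone, since \<open>k choose m\<close> is 0 there, and shifts
  equation \<open>m\<close> by exactly \<open>d\<close>.\<close>

lemma binomial_system_solvable:
  fixes f :: "nat \<Rightarrow> real"
  shows "\<exists>c. \<forall>k\<le>n. (\<Sum>i\<le>n. c i * real (k choose i)) = f k"
proof -
  have "\<exists>c. \<forall>k<m. (\<Sum>i\<le>n. c i * real (k choose i)) = f k" if "m \<le> Suc n" for m
    using that
  proof (induction m)
    case 0 then show ?case by simp
  next
    case (Suc m)
    then obtain c where c: "\<And>k. k < m \<Longrightarrow> (\<Sum>i\<le>n. c i * real (k choose i)) = f k" by auto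
    define d where "d = f m - (\<Sum>i\<le>n. c i * real (m choose i))"
    have "(\<Sum>i\<le>n. (c i + (if i = m then d else 0)) * real (k choose i)) = f k" if "k < Suc m" for k
    proof -
      have "(\<Sum>i\<le>n. (c i + (if i = m then d else 0)) * real (k choose i)) =
          (\<Sum>i\<le>n. c i * real (k choose i) + (if i = m then d * real (k choose m) else 0))"
        by (rule sum.cong) (auto simp: algebra_simps)
      also have "\<dots> = (\<Sum>i\<le>n. c i * real (k choose i)) + d * real (k choose m)"
        using Suc.prems by (simp add: sum.distrib)
      also have "\<dots> = f k"
        using that c[of k] by (cases "k = m") (auto simp: d_def)
      finally show ?thesis .
    qed
    then show ?case by (intro exI[of _ "\<lambda>i. c i + (if i = m then d else 0)"] allI impI)
  qed
  from this[of "Suc n"] show ?thesis by (auto simp: less_Suc_eq_le)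
qed

text \<open>In equation \<open>k\<close> the terms below \<open>k\<close> vanish by induction and
  those above because the binomial coefficient does.\<close>

lemma binomial_system_unique:
  fixes c :: "nat \<Rightarrow> real"
  assumes "\<And>k. k \<le> n \<Longrightarrow> (\<Sum>i\<le>n. c i * real (k choose i)) = 0"
  shows "k \<le> n \<Longrightarrow> c k = 0"
proof (induction k rule: less_induct)
  case (less k)
  have "(\<Sum>i\<le>n. c i * real (k choose i)) = (\<Sum>i\<le>n. if i = k then c k else 0)"
  proof (rule sum.cong[OF refl])
    fix i assume "i \<in> {..n}"
    then show "c i * real (k choose i) = (if i = k then c k else 0)"
      using less.IH[of i] less.prems by (cases i k rule: linorder_cases) auto
  qed
  then show ?case using assms[OF less.prems] less.prems by simp
qed

text \<open>Elements of \<open>Val n\<close> are functions of arbitrary sets constrained only on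
  \<open>Cn n\<close>, so spanning and independence are stated as identities on
  \<open>Cn n\<close>.\<close>

theorem theorem5p4:
  fixes n :: nat
  shows "(\<forall>i\<le>n. intrinsic_volume n i \<in> Val n)
    \<and> (\<forall>\<phi>\<in>Val n. \<exists>c :: nat \<Rightarrow> real.
          \<forall>X\<in>Cn n. \<phi> X = (\<Sum>i\<le>n. c i * intrinsic_volume n i X))
    \<and> (\<forall>c :: nat \<Rightarrow> real. (\<forall>X\<in>Cn n. (\<Sum>i\<le>n. c i * intrinsic_volume n i X) = 0)
          \<longrightarrow> (\<forall>i\<le>n. c i = 0))"
proof (intro conjI allI ballI impI)
  show "intrinsic_volume n i \<in> Val n" for i by (rule intrinsic_volume_Val)
next
  fix \<phi> assume \<phi>: "\<phi> \<in> Val n"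
  obtain c where c: "\<And>k. k \<le> n \<Longrightarrow> (\<Sum>i\<le>n. c i * real (k choose i)) = \<phi> (unit_box {..<k})"
    using binomial_system_solvable[of n "\<lambda>k. \<phi> (unit_box {..<k})"] by auto
  let ?\<sigma> = "\<lambda>X. \<Sum>i\<le>n. c i * intrinsic_volume n i X"
  \<comment> \<open>The coefficients match \<phi> on the unit cubes of every dimension, so the
    difference is a member of \<open>Val n\<close> to which \<open>Val_zero\<close> applies.\<close>
  let ?f = "\<lambda>X. \<phi> X + (-1) * ?\<sigma> X"
  have V: "valuation n (intrinsic_volume n i)" "hcontinuous n (intrinsic_volume n i)" for i
    using intrinsic_volume_Val[of n i] by (simp_all add: Val_def)
  have \<sigma>: "valuation n ?\<sigma>" "hcontinuous n ?\<sigma>"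
    by (rule valuation_lincomb hcontinuous_lincomb; simp add: V)+
  have "hcontinuous n ?f" using \<phi> \<sigma> by (intro hcontinuous_lincomb2) (auto simp: Val_def)
  moreover have "valuation n ?f" using \<phi> \<sigma>(1) by (auto simp: Val_def valuation_def)
  moreover have "invariant n ?f" using \<phi> invariant_intrinsic_volume by (auto simp: Val_def invariant_def)
  ultimately have "?f \<in> Val n" by (simp add: Val_def)
  moreover have "?f (unit_box {..<k}) = 0" if "k \<le> n" for k
    using c[OF that] intrinsic_volume_unit_box[OF that] by simp
  ultimately have "?f X = 0" if "X \<in> Cn n" for X using Val_zero that by blast
  then have "\<forall>X\<in>Cn n. \<phi> X = ?\<sigma> X" by simp
  then show "\<exists>c. \<forall>X\<in>Cn n. \<phi> X = (\<Sum>i\<le>n. c i * intrinsic_volume n i X)" by blast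
next
  fix c :: "nat \<Rightarrow> real" and k
  assume c: "\<forall>X\<in>Cn n. (\<Sum>i\<le>n. c i * intrinsic_volume n i X) = 0" and "k \<le> n"
  have "(\<Sum>i\<le>n. c i * real (k choose i)) = 0" if "k \<le> n" for k
  proof -
    have "unit_box {..<k} \<in> Cn n" using that by (intro unit_box_Cn) auto
    then show ?thesis using c intrinsic_volume_unit_box[OF that] by fastforce
  qed
  then show "c k = 0" using binomial_system_unique \<open>k \<le> n\<close> by blast
qed

end
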